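(* Let $G$ be a connected nonbipartite graph on $n \geq 5$ vertices with girth $g \geq 5$. Then $$Sz(G)-W(G) \geq 2n-5.$$ Equality holds if and only if $G$ is composed of a cycle $C_5$ on $5$ vertices together with either one tree rooted at a vertex of the cycle $C_5$, or two trees rooted, respectively, at two adjacent vertices of the cycle $C_5$.
   Context: All graphs are finite, undirected and simple. For a connected graph $G$, $d_G(u,v)$ is the distance between $u$ and $v$ in $G$, and the Wiener index is $W(G)=\sum_{\{u,v\}\subseteq V(G)} d_G(u,v)$ (sum over unordered pairs of distinct vertices). For an edge $e=uv$ let $n_u(e)=|\{w\in V(G): d_G(u,w)<d_G(v,w)\}|$ and $n_v(e)=|\{w\in V(G): d_G(v,w)<d_G(u,w)\}|$. The Szeged index is $Sz(G)=\sum_{e=uv\in E(G)} n_u(e)n_v(e)$. "A cycle together with a tree rooted at a vertex $v$ of the cycle" means that the tree and the cycle share exactly the vertex $v$ and no edges, and the graph is their union; when there are two trees, they are vertex-disjoint from each other. A tree may be trivial (a single vertex), so $C_5$ itself is included. *)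

theory Defs
  imports Main "HOL-Library.Extended_Nat"
begin

type_synonym 'a ugraph = "'a set \<times> 'a set set"

abbreviation uverts :: "'a ugraph \<Rightarrow> 'a set" where
  "uverts G \<equiv> fst G"

abbreviation uedges :: "'a ugraph \<Rightarrow> 'a set set" where
  "uedges G \<equiv> snd G"

definition simple_graph :: "'a ugraph \<Rightarrow> bool" where
  "simple_graph G \<longleftrightarrow> finite (uverts G) \<and> (\<forall>e\<in>uedges G. e \<subseteq> uverts G \<and> card e = 2)"

definition graph_union :: "'a ugraph \<Rightarrow> 'a ugraph \<Rightarrow> 'a ugraph" where
  "graph_union G H = (uverts G \<union> uverts H, uedges G \<union> uedges H)"


section \<open>Walks, distance, connectedness\<close>

definition graph_walk :: "'a ugraph \<Rightarrow> 'a list \<Rightarrow> bool" where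
  "graph_walk G p \<longleftrightarrow> p \<noteq> [] \<and> set p \<subseteq> uverts G \<and>
     (\<forall>i. Suc i < length p \<longrightarrow> {p ! i, p ! Suc i} \<in> uedges G)"

definition connected_graph :: "'a ugraph \<Rightarrow> bool" where
  "connected_graph G \<longleftrightarrow> uverts G \<noteq> {} \<and>
     (\<forall>u\<in>uverts G. \<forall>v\<in>uverts G. \<exists>p. graph_walk G p \<and> hd p = u \<and> last p = v)"

text \<open>A walk with \<open>k\<close> edges is a list of \<open>k + 1\<close> vertices. The value is meaningful only
  if some walk joins \<open>u\<close> and \<open>v\<close>, in particular for vertices of a connected graph.\<close>

definition graph_dist :: "'a ugraph \<Rightarrow> 'a \<Rightarrow> 'a \<Rightarrow> nat" where
  "graph_dist G u v =
     (LEAST k. \<exists>p. graph_walk G p \<and> hd p = u \<and> last p = v \<and> length p = Suc k)"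

definition bipartite_graph :: "'a ugraph \<Rightarrow> bool" where
  "bipartite_graph G \<longleftrightarrow> (\<exists>A B. A \<union> B = uverts G \<and> A \<inter> B = {} \<and>
     (\<forall>e\<in>uedges G. \<exists>a\<in>A. \<exists>b\<in>B. e = {a, b}))"


section \<open>Cycles, girth, trees\<close>

text \<open>A cycle is given by the list of its vertices in cyclic order, without repeating the
  first vertex at the end; its length is the length of the list.\<close>

definition cycle_edges :: "'a list \<Rightarrow> 'a set set" where
  "cycle_edges c = {{c ! i, c ! (Suc i mod length c)} | i. i < length c}"

definition cycle_graph :: "nat \<Rightarrow> 'a ugraph \<Rightarrow> bool" where
  "cycle_graph k C \<longleftrightarrow> 3 \<le> k \<and>
     (\<exists>c. distinct c \<and> length c = k \<and> C = (set c, cycle_edges c))"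

definition graph_has_cycle :: "'a ugraph \<Rightarrow> nat \<Rightarrow> bool" where
  "graph_has_cycle G k \<longleftrightarrow>
     (\<exists>C. cycle_graph k C \<and> uverts C \<subseteq> uverts G \<and> uedges C \<subseteq> uedges G)"

text \<open>The girth of a graph without cycles is \<open>\<infinity>\<close>.\<close>

definition girth :: "'a ugraph \<Rightarrow> enat" where
  "girth G = Inf {enat k | k. graph_has_cycle G k}"

definition tree_graph :: "'a ugraph \<Rightarrow> bool" where
  "tree_graph T \<longleftrightarrow> simple_graph T \<and> connected_graph T \<and> \<not> (\<exists>k. graph_has_cycle T k)"


section \<open>Wiener index and Szeged index\<close>

text \<open>The value of a symmetric function \<open>f\<close> on an unordered pair \<open>{u, v}\<close>.\<close>

definition pair_value :: "('a \<Rightarrow> 'a \<Rightarrow> nat) \<Rightarrow> 'a set \<Rightarrow> nat" where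
  "pair_value f e = (THE x. \<exists>u v. u \<noteq> v \<and> e = {u, v} \<and> x = f u v)"

definition wiener_index :: "'a ugraph \<Rightarrow> nat" where
  "wiener_index G = (\<Sum>e\<in>{e. e \<subseteq> uverts G \<and> card e = 2}. pair_value (graph_dist G) e)"

definition closer_count :: "'a ugraph \<Rightarrow> 'a \<Rightarrow> 'a \<Rightarrow> nat" where
  "closer_count G u v = card {w \<in> uverts G. graph_dist G u w < graph_dist G v w}"

definition szeged_index :: "'a ugraph \<Rightarrow> nat" where
  "szeged_index G =
     (\<Sum>e\<in>uedges G. pair_value (\<lambda>u v. closer_count G u v * closer_count G v u) e)"

lemma pair_value_eq:
  assumes "u \<noteq> v" and "f u v = f v u"
  shows "pair_value f {u, v} = f u v"
  unfolding pair_value_def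
proof (rule the_equality)
  show "\<exists>a b. a \<noteq> b \<and> {u, v} = {a, b} \<and> f u v = f a b"
    using assms(1) by blast
qed (use assms(2) in \<open>auto simp: doubleton_eq_iff\<close>)

lemma graph_walk_rev:
  assumes "graph_walk G p"
  shows "graph_walk G (rev p)"
proof -
  have "{rev p ! i, rev p ! Suc i} \<in> uedges G" if i: "Suc i < length p" for i
  proof -
    define j where "j = length p - Suc (Suc i)"
    have "{p ! j, p ! Suc j} \<in> uedges G"
      using assms i by (simp add: graph_walk_def j_def)
    moreover have "rev p ! i = p ! Suc j" "rev p ! Suc i = p ! j"
      using i by (simp_all add: rev_nth j_def Suc_diff_Suc)
    ultimately show ?thesis by (simp add: insert_commute)
  qed
  with assms show ?thesis by (simp add: graph_walk_def)
qed

lemma graph_dist_commute: "graph_dist G u v = graph_dist G v u"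
proof -
  have *: "\<exists>q. graph_walk G q \<and> hd q = v \<and> last q = u \<and> length q = Suc k"
    if "graph_walk G p" "hd p = u" "last p = v" "length p = Suc k" for p u v k
    using that graph_walk_rev[OF that(1)]
    by (intro exI[of _ "rev p"]) (auto simp: hd_rev last_rev graph_walk_def)
  have "(\<exists>p. graph_walk G p \<and> hd p = u \<and> last p = v \<and> length p = Suc k) \<longleftrightarrow>
        (\<exists>p. graph_walk G p \<and> hd p = v \<and> last p = u \<and> length p = Suc k)" for k
    using * by blast
  then show ?thesis by (simp add: graph_dist_def)
qed

lemma pair_value_graph_dist:
  "u \<noteq> v \<Longrightarrow> pair_value (graph_dist G) {u, v} = graph_dist G u v"
  by (simp add: pair_value_eq graph_dist_commute)

lemma pair_value_closer_count:
  "u \<noteq> v \<Longrightarrow> pair_value (\<lambda>u v. closer_count G u v * closer_count G v u) {u, v}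
     = closer_count G u v * closer_count G v u"
  by (simp add: pair_value_eq mult.commute)


section \<open>A five-cycle with rooted trees\<close>

definition tree_rooted_on :: "'a ugraph \<Rightarrow> 'a ugraph \<Rightarrow> 'a \<Rightarrow> bool" where
  "tree_rooted_on C T v \<longleftrightarrow> tree_graph T \<and> uverts T \<inter> uverts C = {v} \<and> uedges T \<inter> uedges C = {}"

definition C5_with_one_tree :: "'a ugraph \<Rightarrow> bool" where
  "C5_with_one_tree G \<longleftrightarrow> (\<exists>C T v. cycle_graph 5 C \<and> tree_rooted_on C T v \<and> G = graph_union C T)"

definition C5_with_two_adjacent_trees :: "'a ugraph \<Rightarrow> bool" where
  "C5_with_two_adjacent_trees G \<longleftrightarrow> (\<exists>C T\<^sub>1 T\<^sub>2 v\<^sub>1 v\<^sub>2. cycle_graph 5 C \<and> {v\<^sub>1, v\<^sub>2} \<in> uedges C \<and>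
     tree_rooted_on C T\<^sub>1 v\<^sub>1 \<and> tree_rooted_on C T\<^sub>2 v\<^sub>2 \<and> uverts T\<^sub>1 \<inter> uverts T\<^sub>2 = {} \<and>
     G = graph_union C (graph_union T\<^sub>1 T\<^sub>2))"

end

(* Fix an ordered pair (x, y) and call an edge separating if one end is strictly closer to x and the
   other strictly closer to y. Double counting gives that 2 Sz(G) is the sum over ordered pairs of
   the number of separating edges. The edges of a geodesic separate its ends, so the excess
   (number of separating edges minus distance) is nonnegative and 2 (Sz(G) - W(G)) is the sum of the
   excesses. In a nonbipartite graph every vertex w has an edge uv with d(w,u) = d(w,v), and absence
   of triangles forces positive excess of (w,u) and (w,v), even excess at least 2 if there is no C5;
   then the sum is at least 4n. If there is a five-cycle C, every w has total excess at least 2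
   towards C, and counting V x C and (V - C) x C gives at least 2n + 2(n - 5).

   Equality forces every w to reach C through a single gate, the sets of vertices with a common gate
   to be trees, and gates of vertices outside C never to be at distance 2. Conversely, tree edges are
   bridges, so a separating tree edge lies on every geodesic, and only the cycle contributes excess:
   1 for gates at distance 2 and 0 otherwise. *)

theory Submission
  imports Defs
begin

section \<open>Walks counted by their number of edges\<close>

lemma graph_walk_singleton [simp]: "graph_walk G [x] \<longleftrightarrow> x \<in> uverts G"
  by (simp add: graph_walk_def)

lemma graph_walk_snoc:
  assumes "p \<noteq> []"
  shows "graph_walk G (p @ [y]) \<longleftrightarrow> graph_walk G p \<and> y \<in> uverts G \<and> {last p, y} \<in> uedges G"
proof -
  have "(\<forall>i. Suc i < length (p @ [y]) \<longrightarrow> {(p @ [y]) ! i, (p @ [y]) ! Suc i} \<in> uedges G) \<longleftrightarrow>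
      (\<forall>i. Suc i < length p \<longrightarrow> {p ! i, p ! Suc i} \<in> uedges G) \<and> {last p, y} \<in> uedges G"
    (is "?L \<longleftrightarrow> ?R")
  proof
    assume L: ?L
    have "{p ! i, p ! Suc i} \<in> uedges G" if "Suc i < length p" for i
      using L[rule_format, of i] that by (simp add: nth_append)
    moreover have "{last p, y} \<in> uedges G"
      using L[rule_format, of "length p - 1"] assms by (simp add: nth_append last_conv_nth)
    ultimately show ?R by blast
  next
    assume R: ?R
    show ?L
    proof (intro allI impI)
      fix i assume i: "Suc i < length (p @ [y])"
      show "{(p @ [y]) ! i, (p @ [y]) ! Suc i} \<in> uedges G"
      proof (cases "Suc i < length p")
        case True
        then show ?thesis using R by (simp add: nth_append)
      next
        case False
        with i have "i = length p - 1" by simp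
        then show ?thesis using R assms by (simp add: nth_append last_conv_nth)
      qed
    qed
  qed
  then show ?thesis using assms by (auto simp: graph_walk_def)
qed

text \<open>Keeps only the number of edges of a walk, so that \<open>joined_0\<close> and
  \<open>joined_Suc\<close> replace lists by a recursion at the far end.\<close>

definition joined :: "'a ugraph \<Rightarrow> nat \<Rightarrow> 'a \<Rightarrow> 'a \<Rightarrow> bool" where
  "joined G k x y \<longleftrightarrow> (\<exists>p. graph_walk G p \<and> hd p = x \<and> last p = y \<and> length p = Suc k)"

lemma graph_dist_joined: "graph_dist G x y = (LEAST k. joined G k x y)"
  by (simp add: graph_dist_def joined_def)

lemma joined_0: "joined G 0 x y \<longleftrightarrow> x = y \<and> x \<in> uverts G"
proof
  assume "joined G 0 x y"
  then obtain p where "graph_walk G p" "hd p = x" "last p = y" "length p = Suc 0"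
    unfolding joined_def by blast
  then show "x = y \<and> x \<in> uverts G" by (cases p) auto
next
  assume "x = y \<and> x \<in> uverts G"
  then show "joined G 0 x y" unfolding joined_def by (intro exI[of _ "[x]"]) auto
qed

lemma joined_Suc:
  "joined G (Suc k) x y \<longleftrightarrow> (\<exists>p. joined G k x p \<and> y \<in> uverts G \<and> {p, y} \<in> uedges G)"
proof
  assume "joined G (Suc k) x y"
  then obtain p where p: "graph_walk G p" "hd p = x" "last p = y" "length p = Suc (Suc k)"
    unfolding joined_def by blast
  from p(4) obtain q z where q: "p = q @ [z]" "q \<noteq> []"
    by (cases p rule: rev_cases) fastforce+
  then have "graph_walk G q" "z \<in> uverts G" "{last q, z} \<in> uedges G"
    using p(1) graph_walk_snoc[OF q(2)] by auto
  then show "\<exists>p. joined G k x p \<and> y \<in> uverts G \<and> {p, y} \<in> uedges G"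
    using p q unfolding joined_def by (intro exI[of _ "last q"]) auto
next
  assume "\<exists>p. joined G k x p \<and> y \<in> uverts G \<and> {p, y} \<in> uedges G"
  then obtain q where q: "graph_walk G q" "hd q = x" "length q = Suc k" "y \<in> uverts G"
      "{last q, y} \<in> uedges G"
    unfolding joined_def by blast
  then have "q \<noteq> []" by auto
  then show "joined G (Suc k) x y"
    using q unfolding joined_def by (intro exI[of _ "q @ [y]"]) (auto simp: graph_walk_snoc)
qed

lemma joined_trans: "joined G j x y \<Longrightarrow> joined G k y z \<Longrightarrow> joined G (j + k) x z"
  by (induction k arbitrary: z) (auto simp: joined_0 joined_Suc)

lemma connected_graph_joined:
  "connected_graph G \<longleftrightarrow>
     uverts G \<noteq> {} \<and> (\<forall>u\<in>uverts G. \<forall>v\<in>uverts G. \<exists>k. joined G k u v)"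
proof -
  have "(\<exists>p. graph_walk G p \<and> hd p = u \<and> last p = v) \<longleftrightarrow> (\<exists>k. joined G k u v)" for u v
    unfolding joined_def
    by (metis graph_walk_def length_0_conv not0_implies_Suc)
  then show ?thesis unfolding connected_graph_def by simp
qed

section \<open>Distances in a connected simple graph\<close>

locale connected_simple_graph =
  fixes G :: "'a ugraph"
  assumes simple: "simple_graph G" and connected: "connected_graph G"
begin

abbreviation V where "V \<equiv> uverts G"
abbreviation E where "E \<equiv> uedges G"
abbreviation d where "d \<equiv> graph_dist G"

lemma finite_V [simp, intro]: "finite V"
  using simple by (simp add: simple_graph_def)

lemma finite_E [simp, intro]: "finite E"
  by (rule finite_subset[of _ "Pow V"]) (use simple in \<open>auto simp: simple_graph_def\<close>)

lemma edgeD: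
  assumes "{x, y} \<in> E"
  shows "x \<in> V" "y \<in> V" "x \<noteq> y"
  using simple assms by (fastforce simp: simple_graph_def card_2_iff)+

lemma edge_obtain:
  assumes "e \<in> E"
  obtains x y where "e = {x, y}" "x \<noteq> y"
  using simple assms by (auto simp: simple_graph_def card_2_iff)

text \<open>Connectedness guarantees that the \<open>LEAST\<close> in the definition of distance is
  attained.\<close>

lemma joined_d:
  assumes "x \<in> V" "y \<in> V"
  shows "joined G (d x y) x y"
  using connected assms unfolding connected_graph_joined graph_dist_joined
  by (meson LeastI_ex)

lemma d_le: "joined G k x y \<Longrightarrow> d x y \<le> k"
  unfolding graph_dist_joined by (rule Least_le)

lemma d_commute: "d x y = d y x"
  by (rule graph_dist_commute)

lemma d_self [simp]: "x \<in> V \<Longrightarrow> d x x = 0"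
  using d_le[of 0 x x] by (simp add: joined_0)

lemma d_eq_0: "x \<in> V \<Longrightarrow> y \<in> V \<Longrightarrow> d x y = 0 \<longleftrightarrow> x = y"
  using joined_d[of x y] by (auto simp: joined_0)

lemma d_triangle: "x \<in> V \<Longrightarrow> y \<in> V \<Longrightarrow> z \<in> V \<Longrightarrow> d x z \<le> d x y + d y z"
  by (rule d_le[OF joined_trans[OF joined_d joined_d]])

lemma d_edge: "{x, y} \<in> E \<Longrightarrow> d x y = 1"
  using d_le[of 1 x y] edgeD[of x y] d_eq_0[of x y] by (auto simp: joined_0 joined_Suc)

lemma d_1_edge: "x \<in> V \<Longrightarrow> y \<in> V \<Longrightarrow> d x y = 1 \<Longrightarrow> {x, y} \<in> E"
  using joined_d[of x y] by (auto simp: joined_0 joined_Suc)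

lemma d_step:
  assumes "w \<in> V" "{x, y} \<in> E"
  shows "d w x \<le> d w y + 1" "d w y \<le> d w x + 1"
  using d_triangle[of w x y] d_triangle[of w y x] d_edge[OF assms(2)] edgeD[OF assms(2)] assms(1)
  by (auto simp: d_commute)

text \<open>Take the last but one vertex of a shortest walk; \<open>d_step\<close> prevents it from
  being nearer still.\<close>

lemma d_pred:
  assumes "x \<in> V" "y \<in> V" "d x y \<noteq> 0"
  obtains p where "{p, y} \<in> E" "d x p + 1 = d x y"
proof -
  from assms(3) obtain k where k: "d x y = Suc k" by (cases "d x y") auto
  with joined_d[OF assms(1,2)] obtain p where p: "joined G k x p" "{p, y} \<in> E"
    by (auto simp: joined_Suc)
  have "d x p + 1 = d x y"
    using d_le[OF p(1)] d_step(2)[OF assms(1) p(2)] k by simp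
  with p(2) show ?thesis by (rule that)
qed

section \<open>Separating edges, geodesics and excess\<close>

text \<open>These are the edges in whose Szeged product the pair \<open>(x, y)\<close> is counted,
  with \<open>x\<close> on the side of \<open>u\<close> and \<open>y\<close> on the side of
  \<open>v\<close>.\<close>

definition Sep :: "'a \<Rightarrow> 'a \<Rightarrow> 'a set set" where
  "Sep x y = {{u, v} | u v. {u, v} \<in> E \<and> d x u < d x v \<and> d y v < d y u}"

text \<open>Between vertices the natural subtraction is never truncated, as \<open>card_Sep\<close>
  shows.\<close>

definition excess :: "'a \<Rightarrow> 'a \<Rightarrow> nat" where
  "excess x y = card (Sep x y) - d x y"

lemma finite_Sep [simp, intro]: "finite (Sep x y)"
  by (rule finite_subset[OF _ finite_E]) (auto simp: Sep_def)

lemma Sep_subset: "Sep x y \<subseteq> E"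
  by (auto simp: Sep_def)

lemma SepI: "{u, v} \<in> E \<Longrightarrow> d x u < d x v \<Longrightarrow> d y v < d y u \<Longrightarrow> {u, v} \<in> Sep x y"
  by (auto simp: Sep_def)

lemma Sep_iff:
  "{u, v} \<in> Sep x y \<longleftrightarrow> {u, v} \<in> E \<and>
     (d x u < d x v \<and> d y v < d y u \<or> d x v < d x u \<and> d y u < d y v)"
proof
  assume "{u, v} \<in> Sep x y"
  then obtain u' v' where "{u, v} = {u', v'}" "{u', v'} \<in> E" "d x u' < d x v'" "d y v' < d y u'"
    unfolding Sep_def by blast
  then show "{u, v} \<in> E \<and>
     (d x u < d x v \<and> d y v < d y u \<or> d x v < d x u \<and> d y u < d y v)"
    by (metis doubleton_eq_iff)
next
  assume "{u, v} \<in> E \<and>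
     (d x u < d x v \<and> d y v < d y u \<or> d x v < d x u \<and> d y u < d y v)"
  then show "{u, v} \<in> Sep x y"
    using SepI[of u v x y] SepI[of v u x y] by (metis insert_commute)
qed

lemma Sep_commute: "Sep x y = Sep y x"
  unfolding Sep_def by (metis insert_commute)

lemma excess_commute: "excess x y = excess y x"
  by (simp add: excess_def Sep_commute d_commute)

text \<open>The third argument is the edge set of one shortest path, grown at its far end.\<close>

inductive geodesic :: "'a \<Rightarrow> 'a \<Rightarrow> 'a set set \<Rightarrow> bool" for x where
  refl: "geodesic x x {}"
| step: "geodesic x p K \<Longrightarrow> {p, y} \<in> E \<Longrightarrow> d x p + 1 = d x y \<Longrightarrow> geodesic x y (insert {p, y} K)"

lemma geodesic_exists:
  assumes "x \<in> V" "y \<in> V"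
  shows "\<exists>K. geodesic x y K"
  using assms(2)
proof (induction "d x y" arbitrary: y)
  case 0
  then show ?case using assms d_eq_0 geodesic.refl by metis
next
  case (Suc k)
  then obtain p where p: "{p, y} \<in> E" "d x p + 1 = d x y"
    using d_pred assms by (metis nat.distinct(1))
  then have "k = d x p" "p \<in> V" using Suc.hyps(2) edgeD[of p y] by auto
  then obtain K where "geodesic x p K" using Suc.hyps(1) by blast
  then show ?case using p geodesic.step by blast
qed

lemma geodesic_edge:
  assumes "geodesic x y K" "x \<in> V" "e \<in> K"
  shows "\<exists>u v. e = {u, v} \<and> {u, v} \<in> E \<and> d x u + 1 = d x v \<and> d x v + d v y = d x y"
  using assms
proof (induction rule: geodesic.induct)
  case refl
  then show ?case by simp
next
  case (step p K y)
  note py = edgeD[OF step.hyps(2)]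
  show ?case
  proof (cases "e = {p, y}")
    case True
    then show ?thesis using step py by (intro exI[of _ p] exI[of _ y]) auto
  next
    case False
    then obtain u v where uv: "e = {u, v}" "{u, v} \<in> E" "d x u + 1 = d x v"
        "d x v + d v p = d x p"
      using step by auto
    \<comment> \<open>The vertex \<open>v\<close> stays on a shortest path when the path is extended
      from \<open>p\<close> to \<open>y\<close>: the extension costs a single edge, and the triangle
      inequality gives the other direction.\<close>
    have "d x y \<le> d x v + d v y" "d v y \<le> d v p + 1"
      using d_triangle edgeD[OF uv(2)] py step.prems d_step[OF _ step.hyps(2), of v] by auto
    then have "d x v + d v y = d x y" using uv step.hyps by auto
    then show ?thesis using uv(1-3) by blast
  qed
qed

lemma geodesic_vertex:
  assumes "geodesic x y K" "x \<in> V" "e \<in> K" "z \<in> e"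
  shows "d x z + d z y = d x y"
proof -
  obtain u v where uv: "e = {u, v}" "{u, v} \<in> E" "d x u + 1 = d x v" "d x v + d v y = d x y"
    using geodesic_edge[OF assms(1-3)] by blast
  have y: "y \<in> V" using assms(1,2) by (induction) (auto dest: edgeD)
  have "d x y \<le> d x u + d u y" using d_triangle assms y edgeD[OF uv(2)] by auto
  moreover have "d y u \<le> d y v + 1" using d_step[OF y uv(2)] by auto
  ultimately show ?thesis using uv assms(4) by (auto simp: d_commute)
qed

lemma geodesic_subset_Sep:
  assumes "geodesic x y K" "x \<in> V" "y \<in> V"
  shows "K \<subseteq> Sep x y"
proof
  fix e assume e: "e \<in> K"
  obtain u v where uv: "e = {u, v}" "{u, v} \<in> E" "d x u + 1 = d x v" "d x v + d v y = d x y"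
    using geodesic_edge[OF assms(1,2) e] by blast
  have "d x u + d u y = d x y" using geodesic_vertex[OF assms(1,2) e] uv by auto
  with uv show "e \<in> Sep x y" by (auto intro!: SepI simp: d_commute)
qed

lemma geodesic_card:
  assumes "geodesic x y K" "x \<in> V"
  shows "finite K \<and> card K = d x y"
  using assms
proof (induction rule: geodesic.induct)
  case refl
  then show ?case by simp
next
  case (step p K y)
  \<comment> \<open>If the new edge were old, \<open>y\<close> would lie between \<open>x\<close>
    and \<open>p\<close>, although it is farther from \<open>x\<close> than
    \<open>p\<close>.\<close>
  have "{p, y} \<notin> K"
    using geodesic_vertex[OF step.hyps(1) step.prems, of "{p, y}" y] step.hyps by auto
  then show ?case using step by simp
qed

text \<open>The edges of \<open>K\<close> account for exactly \<open>d x y\<close> separating edges,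
  so every separating edge outside \<open>K\<close> is surplus.\<close>

lemma excess_ge:
  assumes "x \<in> V" "y \<in> V" "geodesic x y K" "F \<subseteq> Sep x y" "F \<inter> K = {}"
  shows "card F \<le> excess x y"
proof -
  have "K \<union> F \<subseteq> Sep x y" using assms geodesic_subset_Sep by auto
  then have "card (K \<union> F) \<le> card (Sep x y)" by (rule card_mono[OF finite_Sep])
  moreover have "card (K \<union> F) = d x y + card F"
    using geodesic_card[OF assms(3,1)] assms(4,5) finite_subset[OF _ finite_Sep]
    by (metis card_Un_disjoint inf_commute)
  ultimately show ?thesis by (simp add: excess_def)
qed

lemma card_Sep:
  assumes "x \<in> V" "y \<in> V"
  shows "card (Sep x y) = d x y + excess x y"
proof -
  obtain K where K: "geodesic x y K" using geodesic_exists assms by blast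
  then have "d x y \<le> card (Sep x y)"
    using geodesic_card geodesic_subset_Sep assms by (metis card_mono finite_Sep)
  then show ?thesis by (simp add: excess_def)
qed

text \<open>An edge with an end on no shortest path avoids whichever geodesic is picked.\<close>

lemma excess_ge_off_geodesics:
  assumes "x \<in> V" "y \<in> V" "F \<subseteq> Sep x y" "\<And>e. e \<in> F \<Longrightarrow> \<exists>z\<in>e. d x z + d z y \<noteq> d x y"
  shows "card F \<le> excess x y"
proof -
  obtain K where K: "geodesic x y K" using geodesic_exists assms by blast
  then show ?thesis using excess_ge[OF assms(1,2) K assms(3)] geodesic_vertex[OF K assms(1)] assms(4)
    by blast
qed

text \<open>Choose a geodesic that enters \<open>x\<close> through \<open>p\<close>; the edge
  \<open>{q, x}\<close> also separates \<open>w\<close> from \<open>x\<close> but is missed by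
  it.\<close>

lemma excess_pos_two_preds:
  assumes "w \<in> V" "{p, x} \<in> E" "{q, x} \<in> E" "p \<noteq> q" "d w p + 1 = d w x" "d w q + 1 = d w x"
  shows "excess w x > 0"
proof -
  note q = edgeD[OF assms(3)] and p = edgeD[OF assms(2)]
  obtain K where K: "geodesic w p K" using geodesic_exists assms(1) p by blast
  have "{q, x} \<notin> K" using geodesic_vertex[OF K assms(1), of "{q, x}" x] assms by auto
  then have "{{q, x}} \<inter> insert {p, x} K = {}" using assms(4) by (auto simp: doubleton_eq_iff)
  moreover have "{q, x} \<in> Sep w x"
    using assms q d_edge[OF assms(3)] by (auto intro!: SepI simp: d_commute)
  ultimately have "card {{q, x}} \<le> excess w x"
    by (intro excess_ge[OF assms(1) q(2) geodesic.step[OF K assms(2,5)]]) simp_all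
  then show ?thesis by simp
qed

section \<open>Double counting of separating edges\<close>

lemma sum_pairs:
  assumes "\<And>x y. f x y = f y x" "\<And>x. x \<in> V \<Longrightarrow> f x x = (0::nat)"
  shows "(\<Sum>x\<in>V. \<Sum>y\<in>V. f x y) = 2 * (\<Sum>e | e \<subseteq> V \<and> card e = 2. pair_value f e)"
proof -
  define D where "D = {p \<in> V \<times> V. fst p \<noteq> snd p}"
  define P where "P = {e. e \<subseteq> V \<and> card e = 2}"
  have "(\<Sum>x\<in>V. \<Sum>y\<in>V. f x y) = (\<Sum>p\<in>V \<times> V. f (fst p) (snd p))"
    by (simp add: sum.cartesian_product case_prod_beta)
  also have "\<dots> = (\<Sum>p\<in>D. f (fst p) (snd p))"
    using assms(2) by (intro sum.mono_neutral_right) (auto simp: D_def)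
  also have "\<dots> = (\<Sum>e\<in>P. \<Sum>p | p \<in> D \<and> {fst p, snd p} = e. f (fst p) (snd p))"
  proof (rule sum.group[symmetric])
    show "finite P" unfolding P_def by (rule finite_subset[of _ "Pow V"]) auto
    show "finite D" unfolding D_def by (rule finite_subset[of _ "V \<times> V"]) auto
    show "(\<lambda>p. {fst p, snd p}) ` D \<subseteq> P" by (auto simp: D_def P_def)
  qed
  also have "\<dots> = (\<Sum>e\<in>P. 2 * pair_value f e)"
  proof (rule sum.cong[OF HOL.refl])
    fix e assume "e \<in> P"
    then obtain u v where uv: "e = {u, v}" "u \<noteq> v" "u \<in> V" "v \<in> V"
      by (auto simp: P_def card_2_iff)
    then have "{p. p \<in> D \<and> {fst p, snd p} = e} = {(u, v), (v, u)}"
      by (auto simp: D_def doubleton_eq_iff)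
    then show "(\<Sum>p | p \<in> D \<and> {fst p, snd p} = e. f (fst p) (snd p)) = 2 * pair_value f e"
      using uv assms(1)[of u v] pair_value_eq[of u v f] by simp
  qed
  finally show ?thesis by (simp add: P_def sum_distrib_left)
qed

text \<open>Count the ordered pairs together with an edge separating them, first by pairs and then
  by edges.\<close>

lemma szeged_sum: "(\<Sum>x\<in>V. \<Sum>y\<in>V. card (Sep x y)) = 2 * szeged_index G"
proof -
  let ?f = "\<lambda>u v. closer_count G u v * closer_count G v u"
  have "(\<Sum>x\<in>V. \<Sum>y\<in>V. card (Sep x y)) = (\<Sum>p\<in>V \<times> V. card {e \<in> E. e \<in> Sep (fst p) (snd p)})"
  proof -
    have "{e \<in> E. e \<in> Sep x y} = Sep x y" for x y using Sep_subset by auto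
    then show ?thesis by (simp add: sum.cartesian_product case_prod_beta)
  qed
  also have "\<dots> = (\<Sum>p\<in>V \<times> V. \<Sum>e\<in>E. if e \<in> Sep (fst p) (snd p) then 1 else 0)"
    by (simp add: sum.If_cases Int_def)
  also have "\<dots> = (\<Sum>e\<in>E. \<Sum>p\<in>V \<times> V. if e \<in> Sep (fst p) (snd p) then 1 else 0)"
    by (rule sum.swap)
  also have "\<dots> = (\<Sum>e\<in>E. card {p \<in> V \<times> V. e \<in> Sep (fst p) (snd p)})"
    by (simp add: sum.If_cases Int_def)
  also have "\<dots> = (\<Sum>e\<in>E. 2 * pair_value ?f e)"
  proof (rule sum.cong[OF HOL.refl])
    fix e assume e: "e \<in> E"
    then obtain u v where uv: "e = {u, v}" "u \<noteq> v" by (rule edge_obtain)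
    define A where "A = {w \<in> V. d u w < d v w}"
    define B where "B = {w \<in> V. d v w < d u w}"
    \<comment> \<open>An edge separates exactly the pairs with one entry on each of its sides; the
      factor 2 comes from the two orders.\<close>
    have "{p \<in> V \<times> V. e \<in> Sep (fst p) (snd p)} = A \<times> B \<union> B \<times> A"
      using e unfolding uv A_def B_def d_commute[of u] d_commute[of v]
      by (auto simp: Sep_iff)
    moreover have "finite A" "finite B" "(A \<times> B) \<inter> (B \<times> A) = {}"
      by (auto simp: A_def B_def)
    ultimately have "card {p \<in> V \<times> V. e \<in> Sep (fst p) (snd p)} = 2 * (card A * card B)"
      by (simp add: card_Un_disjoint card_cartesian_product)
    then show "card {p \<in> V \<times> V. e \<in> Sep (fst p) (snd p)} = 2 * pair_value ?f e"
      unfolding uv(1) pair_value_closer_count[OF uv(2)]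
      by (simp add: closer_count_def A_def B_def)
  qed
  finally show ?thesis by (simp add: szeged_index_def sum_distrib_left)
qed

lemma szeged_minus_wiener:
  "2 * szeged_index G = 2 * wiener_index G + (\<Sum>x\<in>V. \<Sum>y\<in>V. excess x y)"
proof -
  have "(\<Sum>x\<in>V. \<Sum>y\<in>V. card (Sep x y)) = (\<Sum>x\<in>V. \<Sum>y\<in>V. d x y) + (\<Sum>x\<in>V. \<Sum>y\<in>V. excess x y)"
    by (simp add: card_Sep sum.distrib)
  then show ?thesis
    using sum_pairs[of d, OF d_commute d_self] by (simp add: szeged_sum wiener_index_def)
qed

text \<open>Otherwise the parity of the distance from \<open>w\<close> would be a proper
  2-colouring.\<close>

lemma equidistant_edge_exists:
  assumes "\<not> bipartite_graph G" "w \<in> V"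
  obtains u v where "{u, v} \<in> E" "d w u = d w v"
proof (rule ccontr)
  assume "\<not> thesis"
  with that have neq: "d w u \<noteq> d w v" if "{u, v} \<in> E" for u v
    using that by blast
  have "\<exists>a\<in>{x \<in> V. even (d w x)}. \<exists>b\<in>{x \<in> V. odd (d w x)}. e = {a, b}" if "e \<in> E" for e
  proof -
    obtain u v where uv: "e = {u, v}" using edge_obtain \<open>e \<in> E\<close> by blast
    then have E: "{u, v} \<in> E" using that by simp
    have "d w u = d w v + 1 \<or> d w v = d w u + 1"
      using neq[OF E] d_step[OF assms(2) E] by linarith
    then have "even (d w u) \<and> odd (d w v) \<or> even (d w v) \<and> odd (d w u)" by auto
    then show ?thesis using uv edgeD[OF E] by (auto simp: insert_commute)
  qed
  then have "bipartite_graph G"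
    unfolding bipartite_graph_def
    by (intro exI[of _ "{x \<in> V. even (d w x)}"] exI[of _ "{x \<in> V. odd (d w x)}"]) auto
  with assms(1) show False by simp
qed

definition pentagon :: "'a \<Rightarrow> 'a \<Rightarrow> 'a \<Rightarrow> 'a \<Rightarrow> 'a \<Rightarrow> bool" where
  "pentagon a b c p q \<longleftrightarrow> distinct [a, b, c, p, q] \<and>
     {a, b} \<in> E \<and> {b, c} \<in> E \<and> {c, p} \<in> E \<and> {p, q} \<in> E \<and> {q, a} \<in> E"

lemma pentagon_rotate: "pentagon a b c p q \<Longrightarrow> pentagon b c p q a"
  by (auto simp: pentagon_def)

end

section \<open>Excess in triangle-free graphs\<close>

locale triangle_free_graph = connected_simple_graph +
  assumes no_triangle: "{x, y} \<in> E \<Longrightarrow> {y, z} \<in> E \<Longrightarrow> {x, z} \<notin> E"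
begin

text \<open>Let \<open>z\<close> precede \<open>v\<close> on a shortest path from \<open>w\<close>.
  Without triangles \<open>z\<close> is farther from \<open>u\<close> than \<open>v\<close> is, so
  \<open>{z, v}\<close> separates \<open>w\<close> from \<open>u\<close>, while \<open>v\<close>
  lies on no shortest path between them.\<close>

lemma excess_equidistant_edge:
  assumes w: "w \<in> V" and e: "{u, v} \<in> E" and eq: "d w u = d w v"
  shows "excess w u > 0"
proof -
  note uv = edgeD[OF e]
  have "d w v \<noteq> 0" using eq uv w d_eq_0 by metis
  then obtain z where z: "{z, v} \<in> E" "d w z + 1 = d w v" using d_pred w uv by blast
  have "d u z \<noteq> 0" using z eq d_eq_0[of u z] uv edgeD[OF z(1)] by auto
  moreover have "d u z \<noteq> 1"
    using no_triangle[of u z v] z(1) e d_1_edge[of u z] uv edgeD[OF z(1)] by blast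
  ultimately have "d u v < d u z" using d_edge[OF e] by linarith
  then have "{z, v} \<in> Sep w u" using z by (intro SepI) auto
  moreover have "d w v + d v u \<noteq> d w u" using eq d_edge[OF e] by (simp add: d_commute)
  ultimately have "card {{z, v}} \<le> excess w u"
    by (intro excess_ge_off_geodesics w uv) auto
  then show ?thesis by simp
qed

text \<open>One more step back towards \<open>w\<close> gives a second surplus edge
  \<open>{y, z}\<close>, unless \<open>u\<close> is at distance 2 from \<open>y\<close>; then a
  common neighbour closes a five-cycle.\<close>

lemma excess_equidistant_edge_no_pentagon:
  assumes w: "w \<in> V" and e: "{u, v} \<in> E" and eq: "d w u = d w v"
    and no_pent: "\<And>a b c p q. \<not> pentagon a b c p q"
  shows "excess w u \<ge> 2"
proof -
  note uv = edgeD[OF e]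
  have "d w v \<noteq> 0" using eq uv w d_eq_0 by metis
  then obtain z where z: "{z, v} \<in> E" "d w z + 1 = d w v" using d_pred w uv by blast
  note zV = edgeD[OF z(1)]
  have "d u z \<noteq> 0" using z eq d_eq_0[of u z] uv zV by auto
  moreover have nuz: "{u, z} \<notin> E" using no_triangle[of u z v] z(1) e by blast
  then have "d u z \<noteq> 1" using d_1_edge[of u z] uv zV by blast
  moreover have "d u z \<le> d u v + 1" using d_step(1)[OF uv(1) z(1)] .
  ultimately have duz: "d u z = 2" using d_edge[OF e] by linarith
  \<comment> \<open>If \<open>w\<close> were \<open>z\<close>, then \<open>u\<close> would be
    adjacent to \<open>z\<close> and form a triangle with \<open>v\<close>.\<close>
  have "d w z \<noteq> 0"
  proof
    assume "d w z = 0"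
    then have "w = z" "d w u = 1" using d_eq_0 w zV z(2) eq by auto
    then show False using nuz d_1_edge[OF w uv(1)] by (simp add: insert_commute)
  qed
  then obtain y where y: "{y, z} \<in> E" "d w y + 1 = d w z" using d_pred w zV by blast
  note yV = edgeD[OF y(1)]
  \<comment> \<open>The vertex \<open>y\<close> is two levels nearer to \<open>w\<close> than
    \<open>u\<close>.\<close>
  have "d w u \<le> d w y + d y u" by (rule d_triangle[OF w yV(1) uv(1)])
  then have "d u y \<ge> 2" using eq y z by (simp add: d_commute)
  moreover have "d u y \<noteq> 2"
  proof
    assume uy: "d u y = 2"
    then obtain t where t: "{t, y} \<in> E" "d u t + 1 = d u y" using d_pred[OF uv(1) yV(1)] by auto
    note tV = edgeD[OF t(1)]
    have ut: "{u, t} \<in> E" using d_1_edge[OF uv(1) tV(1)] t(2) uy by simp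
    have "d w t \<le> d w y + 1" "d w u \<le> d w t + 1" using d_step[OF w t(1)] d_step[OF w ut] by auto
    then have "d w t + 1 = d w u" using eq y z by linarith
    moreover have "t \<noteq> z" using ut nuz by blast
    ultimately have "pentagon u v z y t"
      using e ut t(1) y z uv zV yV tV eq unfolding pentagon_def by (auto simp: insert_commute)
    then show False using no_pent by blast
  qed
  ultimately have duy: "d u y > 2" by linarith
  have "{z, v} \<in> Sep w u" using z duz d_edge[OF e] by (intro SepI) auto
  moreover have "{y, z} \<in> Sep w u" using y duy duz by (intro SepI) auto
  \<comment> \<open>The common end \<open>z\<close> of both edges is on no shortest path from
    \<open>w\<close> to \<open>u\<close>.\<close>
  moreover have "d w z + d z u \<noteq> d w u" using z(2) eq duz by (simp add: d_commute[of z u])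
  ultimately have "card {{z, v}, {y, z}} \<le> excess w u"
    by (intro excess_ge_off_geodesics w uv) auto
  moreover have "{z, v} \<noteq> {y, z}" using y(2) z(2) by (auto simp: doubleton_eq_iff)
  ultimately show ?thesis by simp
qed

text \<open>Each \<open>w\<close> receives at least 2 from either end of an equidistant
  edge.\<close>

lemma excess_sum_no_pentagon:
  assumes "\<not> bipartite_graph G" "\<And>a b c p q. \<not> pentagon a b c p q"
  shows "4 * card V \<le> (\<Sum>x\<in>V. \<Sum>y\<in>V. excess x y)"
proof -
  have "4 \<le> (\<Sum>y\<in>V. excess w y)" if w: "w \<in> V" for w
  proof -
    obtain u v where uv: "{u, v} \<in> E" "d w u = d w v"
      using equidistant_edge_exists assms(1) w by blast
    have "excess w u \<ge> 2" "excess w v \<ge> 2"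
      using excess_equidistant_edge_no_pentagon[OF w _ _ assms(2), of u v]
        excess_equidistant_edge_no_pentagon[OF w _ _ assms(2), of v u] uv
      by (simp_all add: insert_commute)
    moreover have "(\<Sum>y\<in>{u, v}. excess w y) \<le> (\<Sum>y\<in>V. excess w y)"
      using edgeD[OF uv(1)] by (intro sum_mono2) auto
    ultimately show ?thesis using edgeD[OF uv(1)] by simp
  qed
  then have "(\<Sum>x\<in>V. 4) \<le> (\<Sum>x\<in>V. \<Sum>y\<in>V. excess x y)" by (intro sum_mono)
  then show ?thesis by simp
qed

section \<open>Excess towards a five-cycle\<close>

text \<open>A chord would close a triangle. Distances from vertices other than \<open>a\<close>
  follow by rotation.\<close>

lemma pentagon_dist:
  assumes "pentagon a b c p q"
  shows "a \<in> V" "d a b = 1" "d a c = 2" "d a p = 2" "d a q = 1"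
proof -
  have E: "{a, b} \<in> E" "{b, c} \<in> E" "{c, p} \<in> E" "{p, q} \<in> E" "{q, a} \<in> E" "{a, q} \<in> E"
    and neq: "a \<noteq> c" "a \<noteq> p"
    using assms by (auto simp: pentagon_def insert_commute)
  have V: "a \<in> V" "c \<in> V" "p \<in> V" using E edgeD by blast+
  show "a \<in> V" "d a b = 1" "d a q = 1" using E d_edge edgeD by auto
  have "{a, c} \<notin> E" "{a, p} \<notin> E"
    using no_triangle[of a b c] no_triangle[of a q p] E by (auto simp: insert_commute)
  then have "d a c \<noteq> 1" "d a p \<noteq> 1" using d_1_edge V by blast+
  moreover have "d a c \<noteq> 0" "d a p \<noteq> 0" using V neq by (simp_all add: d_eq_0)
  moreover have "d a c \<le> d a b + 1" "d a p \<le> d a q + 1"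
    using d_step[OF V(1) E(2)] d_step[OF V(1) E(4)] by auto
  ultimately show "d a c = 2" "d a p = 2" using d_edge[OF E(1)] d_edge[OF E(6)] by linarith+
qed

text \<open>Otherwise the parity of the distance from \<open>w\<close> would alternate around an odd
  cycle.\<close>

lemma pentagon_equidistant:
  assumes P: "pentagon a b c p q" and w: "w \<in> V"
  shows "d w a = d w b \<or> d w b = d w c \<or> d w c = d w p \<or> d w p = d w q \<or> d w q = d w a"
proof (rule ccontr)
  assume *: "\<not> ?thesis"
  have E: "{a, b} \<in> E" "{b, c} \<in> E" "{c, p} \<in> E" "{p, q} \<in> E" "{q, a} \<in> E"
    using P by (auto simp: pentagon_def)
  have par: "even (d w x) \<longleftrightarrow> odd (d w y)" if "{x, y} \<in> E" "d w x \<noteq> d w y" for x y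
  proof -
    have "d w x = d w y + 1 \<or> d w y = d w x + 1"
      using d_step[OF w that(1)] that(2) by linarith
    then show ?thesis by auto
  qed
  show False
    using par[OF E(1)] par[OF E(2)] par[OF E(3)] par[OF E(4)] par[OF E(5)] * by blast
qed

lemma pentagon_excess_ge:
  assumes P: "pentagon a b c p q" and w: "w \<in> V"
  shows "2 \<le> excess w a + excess w b + excess w c + excess w p + excess w q"
proof -
  have E: "{a, b} \<in> E" "{b, c} \<in> E" "{c, p} \<in> E" "{p, q} \<in> E" "{q, a} \<in> E"
    using P by (auto simp: pentagon_def)
  have pos: "excess w x > 0 \<and> excess w y > 0" if "{x, y} \<in> E" "d w x = d w y" for x y
    using excess_equidistant_edge[OF w, of x y] excess_equidistant_edge[OF w, of y x] that
    by (simp add: insert_commute)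
  show ?thesis
    using pentagon_equidistant[OF P w] pos[OF E(1)] pos[OF E(2)] pos[OF E(3)] pos[OF E(4)] pos[OF E(5)] by linarith
qed

text \<open>When the total is minimal, the vertex \<open>a\<close> opposite to the equidistant edge
  \<open>{c, p}\<close> is the gate through which \<open>w\<close> reaches the cycle.\<close>

lemma pentagon_gate_aux:
  assumes P: "pentagon a b c p q" and w: "w \<in> V" and eq: "d w c = d w p"
    and sum: "excess w a + excess w b + excess w c + excess w p + excess w q = 2"
  shows "d w b = d w a + 1" "d w q = d w a + 1" "d w c = d w a + 2" "d w p = d w a + 2"
    "excess w a = 0" "excess w b = 0" "excess w q = 0"
proof -
  have E: "{a, b} \<in> E" "{b, c} \<in> E" "{c, p} \<in> E" "{p, q} \<in> E" "{q, a} \<in> E"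
    and neq: "a \<noteq> c" "a \<noteq> p" "b \<noteq> q"
    using P by (auto simp: pentagon_def)
  have pos: "excess w x > 0 \<and> excess w y > 0" if "{x, y} \<in> E" "d w x = d w y" for x y
    using excess_equidistant_edge[OF w, of x y] excess_equidistant_edge[OF w, of y x] that
    by (simp add: insert_commute)
  \<comment> \<open>The ends of an equidistant edge have positive excess, so \<open>c\<close> and
    \<open>p\<close> use up the whole total of 2.\<close>
  from pos[OF E(3) eq] show zero: "excess w a = 0" "excess w b = 0" "excess w q = 0"
    using sum by linarith+
  have diff: "d w a \<noteq> d w b" "d w b \<noteq> d w c" "d w p \<noteq> d w q" "d w q \<noteq> d w a"
    using pos[OF E(1)] pos[OF E(2)] pos[OF E(4)] pos[OF E(5)] zero by linarith+
  \<comment> \<open>A vertex of zero excess has at most one neighbour nearer to \<open>w\<close>.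
    With steps of exactly 1, only the pattern rising from \<open>a\<close> on both sides
    remains.\<close>
  note pk = excess_pos_two_preds[OF w]
  have "\<not> (d w b + 1 = d w a \<and> d w q + 1 = d w a)"
    using pk[of b a q] E neq zero by (auto simp: insert_commute)
  moreover have "\<not> (d w a + 1 = d w b \<and> d w c + 1 = d w b)"
    using pk[of a b c] E neq zero by (auto simp: insert_commute)
  moreover have "\<not> (d w a + 1 = d w q \<and> d w p + 1 = d w q)"
    using pk[of a q p] E neq zero by (auto simp: insert_commute)
  moreover have "d w b = d w a + 1 \<or> d w a = d w b + 1"
    using d_step[OF w E(1)] diff by linarith
  moreover have "d w b = d w c + 1 \<or> d w c = d w b + 1"
    using d_step[OF w E(2)] diff by linarith
  moreover have "d w q = d w p + 1 \<or> d w p = d w q + 1"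
    using d_step[OF w E(4)] diff by linarith
  moreover have "d w q = d w a + 1 \<or> d w a = d w q + 1"
    using d_step[OF w E(5)] diff by linarith
  ultimately show "d w b = d w a + 1" "d w q = d w a + 1" "d w c = d w a + 2" "d w p = d w a + 2"
    using eq by linarith+
qed

end

section \<open>Auxiliary facts on walks, cycles and sums\<close>

lemma joined_commute: "joined G k x y \<Longrightarrow> joined G k y x"
  unfolding joined_def
  by (metis graph_walk_rev graph_walk_def hd_rev last_rev length_rev)

text \<open>Take a vertex where \<open>f\<close> is maximal on the cycle, and its two neighbours.
  With \<open>f\<close> the distance from a root, this finds a vertex with two candidate
  predecessors.\<close>

lemma cycle_graph_max:
  fixes f :: "'a \<Rightarrow> nat"
  assumes "cycle_graph k C"
  obtains x y z where "y \<noteq> z" "{y, x} \<in> uedges C" "{z, x} \<in> uedges C" "f y \<le> f x" "f z \<le> f x"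
proof -
  obtain c where c: "3 \<le> k" "distinct c" "length c = k" "C = (set c, cycle_edges c)"
    using assms unfolding cycle_graph_def by blast
  have "set c \<noteq> {}" using c by auto
  then have "Max (f ` set c) \<in> f ` set c" by (intro Max_in) auto
  then obtain x where "x \<in> set c" "f x = Max (f ` set c)" by auto
  then have x: "x \<in> set c" "\<And>y. y \<in> set c \<Longrightarrow> f y \<le> f x" by auto
  then obtain i where i: "i < k" "x = c ! i" using c(3) by (metis in_set_conv_nth)
  define j where "j = Suc i mod k"
  define m where "m = (if i = 0 then k - 1 else i - 1)"
  have lt: "j < k" "m < k" using i c(1) by (auto simp: j_def m_def)
  have m: "Suc m mod k = i" using i c(1) by (auto simp: m_def)
  \<comment> \<open>The two neighbours differ because the cycle has length at least 3.\<close>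
  have "m \<noteq> j"
  proof (cases "Suc i = k")
    case True
    then show ?thesis using i c(1) by (auto simp: m_def j_def)
  next
    case False
    then have "j = Suc i" using i by (simp add: j_def)
    then show ?thesis using False i c(1) by (auto simp: m_def)
  qed
  then have "c ! m \<noteq> c ! j" using c lt by (simp add: nth_eq_iff_index_eq)
  moreover have "{c ! m, x} \<in> uedges C"
    using m lt i c unfolding c(4) cycle_edges_def by (auto intro!: exI[of _ m])
  moreover have "{x, c ! j} \<in> uedges C"
    using lt i c unfolding c(4) cycle_edges_def j_def by (auto intro!: exI[of _ i])
  ultimately show ?thesis
    using x(2) lt c(3) by (intro that[of "c ! m" "c ! j" x]) (auto simp: insert_commute)
qed

lemma cycle_edges_5:
  "cycle_edges [a, b, c, p, q] = {{a, b}, {b, c}, {c, p}, {p, q}, {q, a}}"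
proof -
  have "cycle_edges [a, b, c, p, q] =
      (\<lambda>i. {[a, b, c, p, q] ! i, [a, b, c, p, q] ! (Suc i mod 5)}) ` {..<5}"
    unfolding cycle_edges_def by auto
  also have "{..<5::nat} = {0, 1, 2, 3, 4}" by auto
  finally show ?thesis by simp
qed

context connected_simple_graph
begin

text \<open>By symmetry of the excess, the block with rows in \<open>C\<close> and columns in
  \<open>V - C\<close> is replaced by its transpose.\<close>

lemma excess_sum_split:
  assumes "C \<subseteq> V"
  shows "(\<Sum>x\<in>V. \<Sum>y\<in>V. excess x y) =
    (\<Sum>x\<in>V. \<Sum>y\<in>C. excess x y) + (\<Sum>x\<in>V - C. \<Sum>y\<in>C. excess x y)
      + (\<Sum>x\<in>V - C. \<Sum>y\<in>V - C. excess x y)"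
proof -
  have split: "(\<Sum>y\<in>V. f y) = (\<Sum>y\<in>V - C. f y) + (\<Sum>y\<in>C. f y)" for f :: "'a \<Rightarrow> nat"
    by (rule sum.subset_diff[OF assms finite_V])
  have "(\<Sum>x\<in>V. \<Sum>y\<in>V - C. excess x y) =
      (\<Sum>x\<in>V - C. \<Sum>y\<in>V - C. excess x y) + (\<Sum>x\<in>C. \<Sum>y\<in>V - C. excess x y)"
    by (rule split)
  also have "(\<Sum>x\<in>C. \<Sum>y\<in>V - C. excess x y) = (\<Sum>x\<in>V - C. \<Sum>y\<in>C. excess x y)"
    by (subst sum.swap) (simp add: excess_commute)
  finally have "(\<Sum>x\<in>V. \<Sum>y\<in>V - C. excess x y) =
      (\<Sum>x\<in>V - C. \<Sum>y\<in>V - C. excess x y) + (\<Sum>x\<in>V - C. \<Sum>y\<in>C. excess x y)" .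
  moreover have "(\<Sum>x\<in>V. \<Sum>y\<in>V. excess x y) =
      (\<Sum>x\<in>V. \<Sum>y\<in>V - C. excess x y) + (\<Sum>x\<in>V. \<Sum>y\<in>C. excess x y)"
    by (simp add: split[of "excess _"] sum.distrib)
  ultimately show ?thesis by simp
qed

end

section \<open>The lower bound in the presence of a five-cycle\<close>

locale pentagon_graph = triangle_free_graph +
  fixes a b c p q
  assumes pentagon: "pentagon a b c p q"
begin

definition C where "C = {a, b, c, p, q}"

lemma C_edges [simp]:
  "{a, b} \<in> E" "{b, c} \<in> E" "{c, p} \<in> E" "{p, q} \<in> E" "{q, a} \<in> E"
  "{b, a} \<in> E" "{c, b} \<in> E" "{p, c} \<in> E" "{q, p} \<in> E" "{a, q} \<in> E"
  using pentagon by (auto simp: pentagon_def insert_commute)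

lemma C_distinct [simp]:
  "a \<noteq> b" "a \<noteq> c" "a \<noteq> p" "a \<noteq> q" "b \<noteq> c" "b \<noteq> p" "b \<noteq> q" "c \<noteq> p" "c \<noteq> q" "p \<noteq> q"
  "b \<noteq> a" "c \<noteq> a" "p \<noteq> a" "q \<noteq> a" "c \<noteq> b" "p \<noteq> b" "q \<noteq> b" "p \<noteq> c" "q \<noteq> c" "q \<noteq> p"
  using pentagon by (auto simp: pentagon_def)

lemmas rotations = pentagon pentagon[THEN pentagon_rotate]
  pentagon[THEN pentagon_rotate, THEN pentagon_rotate]
  pentagon[THEN pentagon_rotate, THEN pentagon_rotate, THEN pentagon_rotate]
  pentagon[THEN pentagon_rotate, THEN pentagon_rotate, THEN pentagon_rotate, THEN pentagon_rotate]

lemmas C_dist [simp] = rotations[THEN pentagon_dist(2)] rotations[THEN pentagon_dist(3)]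
  rotations[THEN pentagon_dist(4)] rotations[THEN pentagon_dist(5)]

lemmas C_verts [simp] = rotations[THEN pentagon_dist(1)]

lemma C_subset: "C \<subseteq> V"
  by (simp add: C_def)

lemma C_in_V: "x \<in> C \<Longrightarrow> x \<in> V"
  using C_subset by blast

lemma finite_C [simp]: "finite C"
  by (simp add: C_def)

lemma card_C: "card C = 5"
  by (simp add: C_def)

lemma sum_C: "(\<Sum>x\<in>C. f x) = f a + f b + f c + f p + f q" for f :: "'a \<Rightarrow> nat"
  by (simp add: C_def)

text \<open>The distances in \<open>C_dist\<close> exclude chords, which would join vertices at
  distance 2.\<close>

lemma edge_C: "x \<in> C \<Longrightarrow> y \<in> C \<Longrightarrow> {x, y} \<in> E \<Longrightarrow> {x, y} \<in> cycle_edges [a, b, c, p, q]"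
  by (drule d_edge) (unfold C_def cycle_edges_5, elim insertE emptyE, simp_all add: insert_commute)

lemma cycle_edges_subset: "cycle_edges [a, b, c, p, q] \<subseteq> E"
  by (simp add: cycle_edges_5)

text \<open>The vertices \<open>u\<close> and \<open>v\<close> are the inner ones of the longer arc
  from \<open>x\<close> to \<open>y\<close>, which has three edges.\<close>

lemma far_C:
  assumes "x \<in> C" "y \<in> C" "d x y = 2"
  shows "\<exists>u\<in>C. \<exists>v\<in>C. {u, v} \<in> E \<and> d x u = 1 \<and> d y u = 2 \<and> d x v = 2 \<and> d y v = 1"
  using assms unfolding C_def by (elim insertE emptyE) simp_all

lemma excess_sum_C_ge: "w \<in> V \<Longrightarrow> 2 \<le> (\<Sum>x\<in>C. excess w x)"
  using pentagon_excess_ge[OF pentagon] by (simp add: sum_C)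

text \<open>The gate is the vertex opposite to an equidistant edge; each of the five cases is
  \<open>pentagon_gate_aux\<close> after a rotation.\<close>

lemma gate_exists:
  assumes w: "w \<in> V" and sum: "(\<Sum>x\<in>C. excess w x) = 2"
  shows "\<exists>g\<in>C. \<forall>x\<in>C. d w x = d w g + d g x \<and> (d g x \<le> 1 \<longrightarrow> excess w x = 0)"
proof -
  note s = sum[unfolded sum_C]
  consider "d w c = d w p" | "d w p = d w q" | "d w q = d w a" | "d w a = d w b" | "d w b = d w c"
    using pentagon_equidistant[OF pentagon w] by auto
  then show ?thesis
  proof cases
    case 1
    then show ?thesis using pentagon_gate_aux[OF rotations(1) w] s by (auto simp: C_def ac_simps)
  next
    case 2
    then show ?thesis using pentagon_gate_aux[OF rotations(2) w] s by (auto simp: C_def ac_simps)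
  next
    case 3
    then show ?thesis using pentagon_gate_aux[OF rotations(3) w] s by (auto simp: C_def ac_simps)
  next
    case 4
    then show ?thesis using pentagon_gate_aux[OF rotations(4) w] s by (auto simp: C_def ac_simps)
  next
    case 5
    then show ?thesis using pentagon_gate_aux[OF rotations(5) w] s by (auto simp: C_def ac_simps)
  qed
qed

text \<open>Rows from \<open>V\<close> and again from \<open>V - C\<close> contribute at least 2
  each, and \<open>V - C\<close> has five vertices fewer. The summand 10 avoids natural
  subtraction.\<close>

lemma excess_sum_ge:
  "4 * card V \<le> (\<Sum>x\<in>V. \<Sum>y\<in>V. excess x y) + 10"
  and excess_sum_tight:
  "(\<Sum>x\<in>V. \<Sum>y\<in>V. excess x y) + 10 = 4 * card V \<Longrightarrow>
    (\<forall>w\<in>V. (\<Sum>x\<in>C. excess w x) = 2) \<and> (\<forall>x\<in>V - C. \<forall>y\<in>V - C. excess x y = 0)"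
proof -
  let ?S = "\<lambda>w. \<Sum>x\<in>C. excess w x"
  have card: "card (V - C) + 5 = card V"
    using card_Diff_subset[OF finite_C C_subset] card_mono[OF finite_V C_subset] card_C by simp
  have 1: "(\<Sum>x\<in>V. 2) \<le> (\<Sum>x\<in>V. ?S x)" by (intro sum_mono excess_sum_C_ge)
  have 2: "(\<Sum>x\<in>V - C. 2) \<le> (\<Sum>x\<in>V - C. ?S x)" by (intro sum_mono excess_sum_C_ge) auto
  note split = excess_sum_split[OF C_subset]
  show "4 * card V \<le> (\<Sum>x\<in>V. \<Sum>y\<in>V. excess x y) + 10"
    using 1 2 card unfolding split by simp
  assume "(\<Sum>x\<in>V. \<Sum>y\<in>V. excess x y) + 10 = 4 * card V"
  then have eq: "(\<Sum>x\<in>V. 2) = (\<Sum>x\<in>V. ?S x)" "(\<Sum>x\<in>V - C. \<Sum>y\<in>V - C. excess x y) = 0"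
    using 1 2 card unfolding split sum_constant of_nat_id by linarith+
  have "?S w = 2" if "w \<in> V" for w
    \<comment> \<open>Equal sums with a termwise inequality force equality in each term.\<close>
    using sum_mono_inv[OF eq(1) excess_sum_C_ge that finite_V] by simp
  moreover have "excess x y = 0" if "x \<in> V - C" "y \<in> V - C" for x y
    using eq(2) that by simp
  ultimately show "(\<forall>w\<in>V. ?S w = 2) \<and> (\<forall>x\<in>V - C. \<forall>y\<in>V - C. excess x y = 0)" by blast
qed

end

section \<open>The structure forced by equality\<close>

locale tight_pentagon_graph = pentagon_graph +
  assumes tight: "(\<Sum>x\<in>V. \<Sum>y\<in>V. excess x y) + 10 = 4 * card V"
begin

definition gate :: "'a \<Rightarrow> 'a" where
  "gate w = (SOME g. g \<in> C \<and> (\<forall>x\<in>C. d w x = d w g + d g x \<and> (d g x \<le> 1 \<longrightarrow> excess w x = 0)))"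

lemma gate_spec:
  assumes "w \<in> V"
  shows "gate w \<in> C \<and> (\<forall>x\<in>C. d w x = d w (gate w) + d (gate w) x \<and>
    (d (gate w) x \<le> 1 \<longrightarrow> excess w x = 0))"
proof -
  have "(\<Sum>x\<in>C. excess w x) = 2" using excess_sum_tight[OF tight] assms by blast
  then have "\<exists>g. g \<in> C \<and> (\<forall>x\<in>C. d w x = d w g + d g x \<and> (d g x \<le> 1 \<longrightarrow> excess w x = 0))"
    using gate_exists[OF assms] by blast
  then show ?thesis unfolding gate_def by (rule someI_ex)
qed

lemma gate_C: "w \<in> V \<Longrightarrow> gate w \<in> C"
  and d_gate: "w \<in> V \<Longrightarrow> x \<in> C \<Longrightarrow> d w x = d w (gate w) + d (gate w) x"
  and excess_near_gate: "w \<in> V \<Longrightarrow> x \<in> C \<Longrightarrow> d (gate w) x \<le> 1 \<Longrightarrow> excess w x = 0"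
  using gate_spec by blast+

lemma gate_V: "w \<in> V \<Longrightarrow> gate w \<in> V"
  using gate_C C_in_V by blast

lemma gate_id: "w \<in> C \<Longrightarrow> gate w = w"
  using d_gate[of w w] C_in_V[of w] gate_V[of w] by (simp add: d_eq_0)

lemma excess_gate: "w \<in> V \<Longrightarrow> excess (gate w) w = 0"
  using excess_near_gate[of w "gate w"] by (simp add: gate_C gate_V excess_commute)

text \<open>Comparing distances to both gates shows that the gates are adjacent and that
  \<open>x\<close> and \<open>y\<close> lie equally deep. At positive depth \<open>y\<close> would
  have two predecessors seen from \<open>gate x\<close>, against the zero excess near a
  gate.\<close>

lemma edge_between_fibres:
  assumes e: "{x, y} \<in> E" and neq: "gate x \<noteq> gate y"
  shows "x \<in> C \<and> y \<in> C"
proof -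
  note V = edgeD[OF e]
  let ?g = "gate x" and ?h = "gate y"
  note gV = gate_V[OF V(1)] and hV = gate_V[OF V(2)]
  have xh: "d x ?h = d x ?g + d ?g ?h" using d_gate[OF V(1) gate_C[OF V(2)]] .
  have yg: "d y ?g = d y ?h + d ?g ?h"
    using d_gate[OF V(2) gate_C[OF V(1)]] by (simp add: d_commute)
  have "d x ?h \<le> d y ?h + 1" "d y ?g \<le> d x ?g + 1"
    using d_step[OF hV e] d_step[OF gV e] by (simp_all add: d_commute)
  moreover have "d ?g ?h \<noteq> 0" using neq d_eq_0[OF gV hV] by simp
  ultimately have gh: "d ?g ?h = 1" and eq: "d x ?g = d y ?h" using xh yg by linarith+
  have "d y ?h = 0"
  proof (rule ccontr)
    assume "d y ?h \<noteq> 0"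
    then have "d ?h y \<noteq> 0" by (simp add: d_commute)
    \<comment> \<open>The vertex \<open>z\<close> leads from \<open>y\<close> back to its own
      gate.\<close>
    then obtain z where z: "{z, y} \<in> E" "d ?h z + 1 = d ?h y" using d_pred[OF hV V(2)] by blast
    have zV: "z \<in> V" using edgeD[OF z(1)] by simp
    have "d ?g z \<le> d ?g ?h + d ?h z" "d ?g y \<le> d ?g z + 1"
      using d_triangle[OF gV hV zV] d_step[OF gV z(1)] by auto
    then have "d ?g z + 1 = d ?g y" using z(2) yg gh by (simp add: d_commute)
    moreover have "d ?g x + 1 = d ?g y" using eq yg gh by (simp add: d_commute)
    moreover have "x \<noteq> z" using z(2) xh eq by (auto simp: d_commute)
    ultimately have "excess ?g y > 0" using excess_pos_two_preds[OF gV e z(1)] by blast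
    moreover have "excess y ?g = 0"
      using excess_near_gate[OF V(2) gate_C[OF V(1)]] gh by (simp add: d_commute)
    ultimately show False by (simp add: excess_commute)
  qed
  then have "x = ?g" "y = ?h" using eq V gV hV by (simp_all add: d_eq_0)
  then show ?thesis using gate_C V by metis
qed

definition fibre :: "'a \<Rightarrow> 'a ugraph" where
  "fibre g = ({w \<in> V. gate w = g}, {e \<in> E. \<forall>w\<in>e. gate w = g})"

text \<open>Going back from a vertex outside \<open>C\<close> towards \<open>g\<close> never leaves
  the fibre, by \<open>edge_between_fibres\<close>.\<close>

lemma fibre_walk_from_root:
  assumes "g \<in> C" "w \<in> V" "gate w = g"
  shows "\<exists>k. joined (fibre g) k g w"
  using assms(2,3)
proof (induction "d g w" arbitrary: w)
  case 0
  then have "w = g" using C_in_V[OF assms(1)] by (simp add: d_eq_0)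
  then show ?case using 0 by (intro exI[of _ 0]) (simp add: joined_0 fibre_def)
next
  case (Suc k)
  note gV = C_in_V[OF assms(1)]
  obtain z where z: "{z, w} \<in> E" "d g z + 1 = d g w"
    using d_pred[OF gV Suc.prems(1)] Suc.hyps(2) by (metis nat.distinct(1))
  note zV = edgeD[OF z(1)]
  have "w \<notin> C" using gate_id[of w] Suc.prems Suc.hyps(2) gV by auto
  then have gz: "gate z = g" using edge_between_fibres[OF z(1)] Suc.prems(2) by auto
  then obtain j where "joined (fibre g) j g z" using Suc.hyps(1)[of z] Suc.hyps(2) z(2) zV by auto
  then have "joined (fibre g) (Suc j) g w"
    using z gz Suc.prems unfolding joined_Suc by (intro exI[of _ z]) (auto simp: fibre_def)
  then show ?case by blast
qed

text \<open>On a cycle, a vertex farthest from \<open>g\<close> would have two predecessors or an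
  equidistant edge; both give positive excess with its own gate, where the excess is zero.\<close>

lemma tree_fibre:
  assumes g: "g \<in> C"
  shows "tree_graph (fibre g)"
  unfolding tree_graph_def
proof (intro conjI notI)
  note gV = C_in_V[OF g]
  show "simple_graph (fibre g)"
    using simple unfolding simple_graph_def fibre_def by auto
  show "connected_graph (fibre g)"
    unfolding connected_graph_joined
  proof (intro conjI ballI)
    show "uverts (fibre g) \<noteq> {}" using gV gate_id[OF g] by (auto simp: fibre_def)
    fix u v assume "u \<in> uverts (fibre g)" "v \<in> uverts (fibre g)"
    then have "\<exists>j. joined (fibre g) j u g" "\<exists>k. joined (fibre g) k g v"
      using fibre_walk_from_root[OF g] joined_commute by (fastforce simp: fibre_def)+
    then show "\<exists>k. joined (fibre g) k u v" using joined_trans by fast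
  qed
  assume "\<exists>k. graph_has_cycle (fibre g) k"
  then obtain k D where D: "cycle_graph k D" "uedges D \<subseteq> uedges (fibre g)"
    unfolding graph_has_cycle_def by blast
  obtain x y z where xyz: "y \<noteq> z" "{y, x} \<in> uedges D" "{z, x} \<in> uedges D"
      "d g y \<le> d g x" "d g z \<le> d g x"
    using cycle_graph_max[OF D(1), of "d g"] by blast
  then have yx: "{y, x} \<in> E" and zx: "{z, x} \<in> E" and gx: "gate x = g"
    using D(2) by (auto simp: fibre_def)
  have ex: "excess g x = 0" using excess_gate[of x] gx edgeD[OF yx] by simp
  have step: "d g w + 1 = d g x" if "{w, x} \<in> E" "d g w \<le> d g x" for w
  proof -
    have "{x, w} \<in> E" using that(1) by (simp add: insert_commute)
    then have "d g x \<noteq> d g w" using excess_equidistant_edge[OF gV] ex by fastforce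
    then show ?thesis using d_step[OF gV that(1)] that(2) by linarith
  qed
  have "excess g x > 0"
    using excess_pos_two_preds[OF gV yx zx xyz(1)] step yx zx xyz by blast
  then show False using ex by simp
qed

lemma fibre_C: "g \<in> C \<Longrightarrow> uverts (fibre g) \<inter> C = {g}"
  using gate_id C_in_V by (auto simp: fibre_def)

lemma tree_rooted_fibre:
  assumes "g \<in> C"
  shows "tree_rooted_on (C, cycle_edges [a, b, c, p, q]) (fibre g) g"
  unfolding tree_rooted_on_def
proof (intro conjI)
  show "uedges (fibre g) \<inter> uedges (C, cycle_edges [a, b, c, p, q]) = {}"
  proof -
    \<comment> \<open>Vertices of \<open>C\<close> are their own gates, so the ends of a cycle edge
      have different gates.\<close>
    have "{x, y} \<notin> uedges (fibre g)" if "{x, y} \<in> E" "x \<in> C" "y \<in> C" for x y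
      using edgeD(3)[OF that(1)] gate_id that(2,3) by (auto simp: fibre_def)
    from this[OF C_edges(1)] this[OF C_edges(2)] this[OF C_edges(3)] this[OF C_edges(4)]
      this[OF C_edges(5)]
    show ?thesis by (auto simp: cycle_edges_5 C_def)
  qed
qed (use tree_fibre fibre_C assms in auto)

text \<open>Otherwise the middle edge of the longer arc between the gates would separate
  \<open>x\<close> from \<open>y\<close> without being on a shortest path, and the excess outside
  \<open>C\<close> would not vanish.\<close>

lemma nontrivial_fibres_near:
  assumes x: "x \<in> V - C" and y: "y \<in> V - C"
  shows "d (gate x) (gate y) \<noteq> 2"
proof
  let ?g = "gate x" and ?h = "gate y"
  assume gh: "d ?g ?h = 2"
  have V: "x \<in> V" "y \<in> V" and g: "?g \<in> C" and h: "?h \<in> C" using x y gate_C by auto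
  obtain u v where uv: "u \<in> C" "v \<in> C" "{u, v} \<in> E" "d ?g u = 1" "d ?h u = 2"
      "d ?g v = 2" "d ?h v = 1"
    using far_C[OF g h gh] by blast
  have dist: "d x u = d x ?g + 1" "d x v = d x ?g + 2" "d y u = d y ?h + 2" "d y v = d y ?h + 1"
    using d_gate[OF V(1) uv(1)] d_gate[OF V(1) uv(2)] d_gate[OF V(2) uv(1)] d_gate[OF V(2) uv(2)] uv
    by simp_all
  have "d x y \<le> d x ?h + d ?h y" using d_triangle V gate_V by blast
  then have "d x y \<le> d x ?g + 2 + d y ?h" using d_gate[OF V(1) h] gh by (simp add: d_commute)
  moreover have "{u, v} \<in> Sep x y" using uv(3) dist by (intro SepI) auto
  ultimately have "card {{u, v}} \<le> excess x y"
    using dist by (intro excess_ge_off_geodesics V) (auto simp: d_commute[of _ y])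
  moreover have "excess x y = 0" using excess_sum_tight[OF tight] x y by blast
  ultimately show False by simp
qed

text \<open>A set of vertices of a five-cycle without two at distance 2 fits into one edge.\<close>

lemma nontrivial_fibres_adjacent_pair:
  obtains g h where "g \<in> C" "h \<in> C" "{g, h} \<in> E" "\<And>x. x \<in> V - C \<Longrightarrow> gate x = g \<or> gate x = h"
proof -
  define N where "N = gate ` (V - C)"
  have N: "N \<subseteq> {a, b, c, p, q}" using gate_C by (auto simp: N_def C_def)
  have far: "\<not> (g \<in> N \<and> h \<in> N)" if "d g h = 2" for g h
    using that nontrivial_fibres_near by (auto simp: N_def)
  have "\<exists>g\<in>C. \<exists>h\<in>C. {g, h} \<in> E \<and> N \<subseteq> {g, h}"
  proof -
    have "\<not> (a \<in> N \<and> c \<in> N)" "\<not> (a \<in> N \<and> p \<in> N)" "\<not> (b \<in> N \<and> p \<in> N)" "\<not> (b \<in> N \<and> q \<in> N)"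
      "\<not> (c \<in> N \<and> q \<in> N)" by (intro far; simp)+
    then have "N \<subseteq> {a, b} \<or> N \<subseteq> {b, c} \<or> N \<subseteq> {c, p} \<or> N \<subseteq> {p, q} \<or> N \<subseteq> {q, a}"
      using N by blast
    then show ?thesis unfolding C_def using C_edges by blast
  qed
  then show ?thesis using that unfolding N_def by blast
qed

text \<open>The fibres over the ends of one edge serve as the two trees, either of which may be
  trivial; the cycle covers all other vertices.\<close>

lemma two_adjacent_trees: "C5_with_two_adjacent_trees G"
proof -
  obtain g h where gh: "g \<in> C" "h \<in> C" "{g, h} \<in> E"
      and fib: "\<And>x. x \<in> V - C \<Longrightarrow> gate x = g \<or> gate x = h"
    by (rule nontrivial_fibres_adjacent_pair) blast
  let ?C = "(C, cycle_edges [a, b, c, p, q])"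
  have "cycle_graph 5 ?C"
    unfolding cycle_graph_def C_def by (intro conjI exI[of _ "[a, b, c, p, q]"]) auto
  moreover have "{g, h} \<in> uedges ?C" using edge_C[OF gh] by simp
  moreover have "uverts (fibre g) \<inter> uverts (fibre h) = {}"
    using edgeD[OF gh(3)] by (auto simp: fibre_def)
  moreover have "G = graph_union ?C (graph_union (fibre g) (fibre h))"
  proof (rule prod_eqI)
    show "V = uverts (graph_union ?C (graph_union (fibre g) (fibre h)))"
      using fib C_subset by (auto simp: graph_union_def fibre_def)
    have "e \<in> cycle_edges [a, b, c, p, q] \<union> uedges (fibre g) \<union> uedges (fibre h)" if e: "e \<in> E" for e
    proof -
      obtain x y where xy: "e = {x, y}" using e by (rule edge_obtain)
      then have E: "{x, y} \<in> E" using e by simp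
      show ?thesis
      proof (cases "x \<in> C \<and> y \<in> C")
        case True
        then show ?thesis using edge_C E xy by blast
      next
        case False
        then have "gate x = gate y" using edge_between_fibres[OF E] by blast
        \<comment> \<open>An edge not inside \<open>C\<close> has an end outside
          \<open>C\<close>.\<close>
        moreover have "gate x = g \<or> gate x = h \<or> gate y = g \<or> gate y = h"
          using False fib edgeD[OF E] by blast
        ultimately show ?thesis using E xy by (auto simp: fibre_def)
      qed
    qed
    then show "E = uedges (graph_union ?C (graph_union (fibre g) (fibre h)))"
      using cycle_edges_subset by (auto simp: graph_union_def fibre_def)
  qed
  ultimately show ?thesis
    unfolding C5_with_two_adjacent_trees_def
    using tree_rooted_fibre[OF gh(1)] tree_rooted_fibre[OF gh(2)] by blast
qed

end

section \<open>Bridges and reachability\<close>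

definition adjacency :: "'a set set \<Rightarrow> ('a \<times> 'a) set" where
  "adjacency F = {(x, y). {x, y} \<in> F}"

lemma adjacency_sym: "(x, y) \<in> (adjacency F)\<^sup>* \<Longrightarrow> (y, x) \<in> (adjacency F)\<^sup>*"
  by (rule symD[OF sym_rtrancl]) (auto simp: sym_def adjacency_def insert_commute)

text \<open>If the new start vertex already occurs, the walk is cut at that occurrence.\<close>

lemma adjacency_rtrancl_distinct_walk:
  assumes "(x, y) \<in> (adjacency F)\<^sup>*"
  shows "\<exists>c. c \<noteq> [] \<and> hd c = x \<and> last c = y \<and> distinct c \<and>
    (\<forall>i. Suc i < length c \<longrightarrow> {c ! i, c ! Suc i} \<in> F)"
  using assms
proof (induction rule: converse_rtrancl_induct)
  case base
  then show ?case by (intro exI[of _ "[y]"]) simp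
next
  case (step x z)
  then obtain c where c: "c \<noteq> []" "hd c = z" "last c = y" "distinct c"
      "\<And>i. Suc i < length c \<Longrightarrow> {c ! i, c ! Suc i} \<in> F"
    by blast
  show ?case
  proof (cases "x \<in> set c")
    case True
    then obtain c1 c2 where s: "c = c1 @ x # c2" by (meson split_list)
    have "{(x # c2) ! i, (x # c2) ! Suc i} \<in> F" if "Suc i < length (x # c2)" for i
      using c(5)[of "length c1 + i"] that by (simp add: s nth_append)
    then show ?thesis using c s by (intro exI[of _ "x # c2"]) auto
  next
    case False
    have "{(x # c) ! i, (x # c) ! Suc i} \<in> F" if "Suc i < length (x # c)" for i
      using that step.hyps(1) c(1,2,5) by (cases i) (auto simp: adjacency_def hd_conv_nth)
    then show ?thesis using c False by (intro exI[of _ "x # c"]) auto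
  qed
qed

text \<open>A path from \<open>u\<close> to \<open>v\<close> avoiding the edge \<open>{u, v}\<close>
  would be closed to a cycle by it.\<close>

lemma tree_edge_bridge:
  assumes T: "tree_graph T" and e: "{u, v} \<in> uedges T"
  shows "(u, v) \<notin> (adjacency (uedges T - {{u, v}}))\<^sup>*"
proof
  assume reach: "(u, v) \<in> (adjacency (uedges T - {{u, v}}))\<^sup>*"
  obtain c where c: "c \<noteq> []" "hd c = u" "last c = v" "distinct c"
      "\<And>i. Suc i < length c \<Longrightarrow> {c ! i, c ! Suc i} \<in> uedges T - {{u, v}}"
    using adjacency_rtrancl_distinct_walk[OF reach] by blast
  have simple: "\<And>f. f \<in> uedges T \<Longrightarrow> f \<subseteq> uverts T \<and> card f = 2"
    using T by (simp add: tree_graph_def simple_graph_def)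
  then have uv: "u \<noteq> v" using e by fastforce
  have ends: "c ! 0 = u" "c ! (length c - 1) = v"
    using c by (simp_all add: hd_conv_nth last_conv_nth)
  \<comment> \<open>Length 1 would mean \<open>u = v\<close>, and length 2 a walk along the removed
    edge.\<close>
  have "length c \<noteq> 1" using ends uv by auto
  moreover have "length c \<noteq> 2" using ends c(5)[of 0] by auto
  ultimately have len: "3 \<le> length c" using c(1) by (cases "length c") auto
  have ce: "cycle_edges c \<subseteq> uedges T"
  proof
    fix f assume "f \<in> cycle_edges c"
    then obtain i where i: "f = {c ! i, c ! (Suc i mod length c)}" "i < length c"
      unfolding cycle_edges_def by blast
    show "f \<in> uedges T"
    proof (cases "Suc i < length c")
      case True
      then show ?thesis using i c(5)[of i] by simp
    next
      case False
      \<comment> \<open>The wrap-around edge joins \<open>v\<close> to \<open>u\<close>, so it is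
        the removed edge itself.\<close>
      then have "i = length c - 1" "Suc i = length c" using i(2) by simp_all
      then show ?thesis using i ends e by (simp add: insert_commute)
    qed
  qed
  moreover have "set c \<subseteq> uverts T"
  proof
    fix x assume "x \<in> set c"
    then obtain i where "i < length c" "x = c ! i" by (auto simp: in_set_conv_nth)
    then have "{x, c ! (Suc i mod length c)} \<in> cycle_edges c"
      unfolding cycle_edges_def by blast
    then show "x \<in> uverts T" using simple ce by blast
  qed
  ultimately have "graph_has_cycle T (length c)"
    unfolding graph_has_cycle_def cycle_graph_def using len c(4)
    by (intro exI[of _ "(set c, cycle_edges c)"]) auto
  then show False using T unfolding tree_graph_def by blast
qed

context connected_simple_graph
begin

lemma geodesic_avoids_reachable:
  assumes "geodesic x y K" "e \<notin> K"
  shows "(x, y) \<in> (adjacency (E - {e}))\<^sup>*"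
  using assms
proof (induction rule: geodesic.induct)
  case refl
  then show ?case by simp
next
  case (step p K y)
  then have "(p, y) \<in> adjacency (E - {e})" by (auto simp: adjacency_def)
  then show ?case using step by (meson insertCI rtrancl.rtrancl_into_rtrancl)
qed

text \<open>A geodesic from \<open>x\<close> to \<open>u\<close> cannot pass through the farther
  vertex \<open>v\<close>.\<close>

lemma reachable_avoiding_edge:
  assumes "x \<in> V" "u \<in> V" "v \<in> V" "d x u < d x v"
  shows "(x, u) \<in> (adjacency (E - {{u, v}}))\<^sup>*"
proof -
  obtain K where K: "geodesic x u K" using geodesic_exists assms by blast
  have "{u, v} \<notin> K" using geodesic_vertex[OF K assms(1), of "{u, v}" v] assms(4) by auto
  then show ?thesis using geodesic_avoids_reachable[OF K] by blast
qed

text \<open>If the geodesic missed the edge, one end would reach \<open>x\<close>, then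
  \<open>y\<close> along the geodesic, then the other end, all without the edge.\<close>

lemma separating_bridge_on_geodesic:
  assumes "x \<in> V" "y \<in> V" "geodesic x y K" "{u, v} \<in> Sep x y"
    and bridge: "(u, v) \<notin> (adjacency (E - {{u, v}}))\<^sup>*"
  shows "{u, v} \<in> K"
proof (rule ccontr)
  assume "{u, v} \<notin> K"
  then have xy: "(x, y) \<in> (adjacency (E - {{u, v}}))\<^sup>*" by (rule geodesic_avoids_reachable[OF assms(3)])
  have E: "{u, v} \<in> E" using assms(4) Sep_subset by blast
  note uv = edgeD[OF E]
  have r: "{v, u} = {u, v}" by (simp add: insert_commute)
  consider "d x u < d x v" "d y v < d y u" | "d x v < d x u" "d y u < d y v"
    using assms(4) by (auto simp: Sep_iff)
  then have "(u, v) \<in> (adjacency (E - {{u, v}}))\<^sup>*"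
  proof cases
    case 1
    then have "(x, u) \<in> (adjacency (E - {{u, v}}))\<^sup>*" "(y, v) \<in> (adjacency (E - {{u, v}}))\<^sup>*"
      using reachable_avoiding_edge[OF assms(1) uv(1,2)] reachable_avoiding_edge[OF assms(2) uv(2,1)]
      by (simp_all add: r)
    then show ?thesis using xy adjacency_sym rtrancl_trans by metis
  next
    case 2
    then have "(x, v) \<in> (adjacency (E - {{u, v}}))\<^sup>*" "(y, u) \<in> (adjacency (E - {{u, v}}))\<^sup>*"
      using reachable_avoiding_edge[OF assms(1) uv(2,1)] reachable_avoiding_edge[OF assms(2) uv(1,2)]
      by (simp_all add: r)
    then show ?thesis using xy adjacency_sym rtrancl_trans by metis
  qed
  with bridge show False by contradiction
qed

end

section \<open>The upper bound for a five-cycle with trees\<close>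

text \<open>Here \<open>r\<close> retracts each vertex to the root of its tree, and acyclicity is
  expressed by bridges. By \<open>r_near\<close>, roots of nontrivial trees are equal or
  adjacent.\<close>

locale pentagon_with_trees = pentagon_graph +
  fixes r :: "'a \<Rightarrow> 'a"
  assumes r_C: "x \<in> V \<Longrightarrow> r x \<in> C"
    and r_id: "x \<in> C \<Longrightarrow> r x = x"
    and r_edge: "{x, y} \<in> E \<Longrightarrow> r x = r y \<or> x \<in> C \<and> y \<in> C"
    and r_bridge: "{x, y} \<in> E \<Longrightarrow> r x = r y \<Longrightarrow> (x, y) \<notin> (adjacency (E - {{x, y}}))\<^sup>*"
    and r_near: "x \<in> V - C \<Longrightarrow> y \<in> V - C \<Longrightarrow> d (r x) (r y) \<noteq> 2"
begin

lemma r_V: "x \<in> V \<Longrightarrow> r x \<in> V"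
  using r_C C_in_V by blast

text \<open>Each step of the walk changes either the part inside a tree or the part along the cycle,
  by at most 1.\<close>

lemma joined_root:
  assumes "x \<in> C" "joined G k x y"
  shows "d x (r y) + d (r y) y \<le> k"
  using assms(2)
proof (induction k arbitrary: y)
  case 0
  then show ?case using r_id[OF assms(1)] by (auto simp: joined_0)
next
  case (Suc k)
  then obtain z where z: "joined G k x z" "{z, y} \<in> E" by (auto simp: joined_Suc)
  note zV = edgeD[OF z(2)] and xV = C_in_V[OF assms(1)]
  consider "r z = r y" | "z \<in> C" "y \<in> C" using r_edge[OF z(2)] by blast
  then show ?case
  proof cases
    case 1
    then show ?thesis
      using Suc.IH[OF z(1)] d_step[OF r_V[OF zV(2)] z(2)] by simp
  next
    case 2
    then show ?thesis
      using Suc.IH[OF z(1)] d_step[OF xV z(2)] zV by (simp add: r_id)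
  qed
qed

lemma d_root: "x \<in> C \<Longrightarrow> y \<in> V \<Longrightarrow> d y x = d y (r y) + d (r y) x"
  using joined_root[of x "d x y" y] joined_d[of x y] d_triangle[of y "r y" x] C_in_V[of x] r_V[of y]
  by (simp add: d_commute)

text \<open>Along the geodesic the root changes only at edges inside \<open>C\<close>, and then by
  distance at most 1.\<close>

lemma geodesic_cycle_edges:
  assumes "geodesic x y K" "x \<in> V"
  shows "d (r x) (r y) \<le> card {e \<in> K. e \<subseteq> C}"
  using assms
proof (induction rule: geodesic.induct)
  case refl
  then show ?case by (simp add: r_V)
next
  case (step z K y)
  note zV = edgeD[OF step.hyps(2)]
  have fin: "finite K" using geodesic_card[OF step.hyps(1) step.prems] by simp
  consider "r z = r y" | "z \<in> C" "y \<in> C" using r_edge[OF step.hyps(2)] by blast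
  then show ?case
  proof cases
    case 1
    have "card {e \<in> K. e \<subseteq> C} \<le> card {e \<in> insert {z, y} K. e \<subseteq> C}"
      using fin by (intro card_mono) auto
    then show ?thesis using step.IH[OF step.prems] 1 by simp
  next
    case 2
    have "{z, y} \<notin> K"
      using geodesic_vertex[OF step.hyps(1) step.prems, of "{z, y}" y] step.hyps by auto
    moreover have "{e \<in> insert {z, y} K. e \<subseteq> C} = insert {z, y} {e \<in> K. e \<subseteq> C}"
      using 2 by auto
    ultimately have "card {e \<in> insert {z, y} K. e \<subseteq> C} = Suc (card {e \<in> K. e \<subseteq> C})"
      using fin by simp
    moreover have "d (r x) (r y) \<le> d (r x) (r z) + 1"
      using d_step[OF r_V[OF step.prems] step.hyps(2)] 2 by (simp add: r_id)
    ultimately show ?thesis using step.IH[OF step.prems] by simp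
  qed
qed

lemma sum_cycle_edges:
  "(\<Sum>e\<in>cycle_edges [a, b, c, p, q]. f e) = f {a, b} + f {b, c} + f {c, p} + f {p, q} + f {q, a}"
  for f :: "'a set \<Rightarrow> nat"
  unfolding cycle_edges_5 by (simp add: doubleton_eq_iff)

text \<open>The edges of the shorter arc separate, and at distance 2 so does the middle edge of the
  longer arc.\<close>

lemma card_Sep_cycle:
  assumes "g \<in> C" "h \<in> C"
  shows "card (Sep g h \<inter> cycle_edges [a, b, c, p, q]) = d g h + (if d g h = 2 then 1 else 0)"
proof -
  let ?Z = "cycle_edges [a, b, c, p, q]"
  have "card (Sep g h \<inter> ?Z) = (\<Sum>e\<in>?Z. if e \<in> Sep g h then 1 else 0)"
    by (simp add: sum.If_cases cycle_edges_5 Int_def conj_commute)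
  also have "\<dots> = d g h + (if d g h = 2 then 1 else 0)"
    using assms unfolding sum_cycle_edges Sep_iff unfolding C_def
    by (elim insertE emptyE) simp_all
  finally show ?thesis .
qed

text \<open>Separating edges not inside \<open>C\<close> are bridges and lie on the geodesic
  \<open>K\<close>. Those inside \<open>C\<close> also separate the roots, so they exceed the cycle
  edges of \<open>K\<close> by at most 1.\<close>

lemma excess_le:
  assumes x: "x \<in> V" and y: "y \<in> V"
  shows "excess x y \<le> (if d (r x) (r y) = 2 then 1 else 0)"
proof -
  let ?Z = "cycle_edges [a, b, c, p, q]"
  obtain K where K: "geodesic x y K" using geodesic_exists[OF x y] by blast
  have Kc: "finite K" "card K = d x y" using geodesic_card[OF K x] by simp_all
  have "{e \<in> Sep x y. \<not> e \<subseteq> C} \<subseteq> {e \<in> K. \<not> e \<subseteq> C}"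
  proof
    fix e assume e: "e \<in> {e \<in> Sep x y. \<not> e \<subseteq> C}"
    then have eE: "e \<in> E" using Sep_subset by blast
    then obtain u v where uv: "e = {u, v}" by (rule edge_obtain)
    with e eE have "{u, v} \<in> E" "r u = r v" using r_edge[of u v] by auto
    then have "{u, v} \<in> K"
      using separating_bridge_on_geodesic[OF x y K] r_bridge e uv by blast
    then show "e \<in> {e \<in> K. \<not> e \<subseteq> C}" using e uv by simp
  qed
  then have 1: "card {e \<in> Sep x y. \<not> e \<subseteq> C} \<le> card {e \<in> K. \<not> e \<subseteq> C}"
    using Kc(1) by (intro card_mono) auto
  have "{e \<in> Sep x y. e \<subseteq> C} \<subseteq> Sep (r x) (r y) \<inter> ?Z"
  proof
    fix e assume e: "e \<in> {e \<in> Sep x y. e \<subseteq> C}"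
    then have eE: "e \<in> E" using Sep_subset by blast
    then obtain u v where uv: "e = {u, v}" by (rule edge_obtain)
    have C: "u \<in> C" "v \<in> C" using e uv by auto
    note dist = d_root[OF C(1) x] d_root[OF C(2) x] d_root[OF C(1) y] d_root[OF C(2) y]
    have "{u, v} \<in> Sep x y" using e uv by simp
    then have "{u, v} \<in> Sep (r x) (r y)" unfolding Sep_iff dist by auto
    then show "e \<in> Sep (r x) (r y) \<inter> ?Z" using edge_C[OF C] eE uv by simp
  qed
  then have "card {e \<in> Sep x y. e \<subseteq> C} \<le> card (Sep (r x) (r y) \<inter> ?Z)"
    by (intro card_mono) auto
  then have 2: "card {e \<in> Sep x y. e \<subseteq> C} \<le> d (r x) (r y) + (if d (r x) (r y) = 2 then 1 else 0)"
    using card_Sep_cycle[OF r_C[OF x] r_C[OF y]] by simp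
  have split: "card S = card {e \<in> S. \<not> e \<subseteq> C} + card {e \<in> S. e \<subseteq> C}" if "finite S" for S
    using that card_Un_disjoint[of "{e \<in> S. \<not> e \<subseteq> C}" "{e \<in> S. e \<subseteq> C}"]
    by (subst card_Un_disjoint[symmetric]) (auto intro!: arg_cong[of _ _ card])
  have "card (Sep x y) \<le> d x y + (if d (r x) (r y) = 2 then 1 else 0)"
    using 1 2 split[of "Sep x y"] split[OF Kc(1)] Kc(2) geodesic_cycle_edges[OF K x] by simp
  then show ?thesis by (simp add: excess_def)
qed

lemma excess_sum_C_le:
  assumes "w \<in> V"
  shows "(\<Sum>x\<in>C. excess w x) \<le> 2"
proof -
  have "(\<Sum>x\<in>C. excess w x) \<le> (\<Sum>x\<in>C. if d (r w) x = 2 then 1 else 0)"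
    by (rule sum_mono, rule order_trans[OF excess_le[OF assms]]) (auto simp: C_in_V r_id)
  \<comment> \<open>Exactly two vertices of \<open>C\<close> are at distance 2 from
    \<open>r w\<close>.\<close>
  also have "\<dots> = 2"
    using r_C[OF assms] unfolding sum_C unfolding C_def by (elim insertE emptyE) simp_all
  finally show ?thesis .
qed

lemma excess_sum_le: "(\<Sum>x\<in>V. \<Sum>y\<in>V. excess x y) + 10 \<le> 4 * card V"
proof -
  have card: "card (V - C) + 5 = card V"
    using card_Diff_subset[OF finite_C C_subset] card_mono[OF finite_V C_subset] card_C by simp
  have "(\<Sum>x\<in>V. \<Sum>y\<in>C. excess x y) \<le> (\<Sum>x\<in>V. 2)"
    "(\<Sum>x\<in>V - C. \<Sum>y\<in>C. excess x y) \<le> (\<Sum>x\<in>V - C. 2)"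
    by (intro sum_mono excess_sum_C_le; simp)+
  moreover have "(\<Sum>x\<in>V - C. \<Sum>y\<in>V - C. excess x y) = 0"
    using excess_le r_near by (intro sum.neutral ballI) fastforce
  ultimately show ?thesis using card unfolding excess_sum_split[OF C_subset] by simp
qed

end

section \<open>From rooted trees to the retraction\<close>

text \<open>Contract everything outside \<open>T\<close> to the root \<open>v\<close>: a walk in
  \<open>F\<close> avoiding \<open>{x, y}\<close> becomes one in \<open>T\<close>, where that edge
  is a bridge.\<close>

lemma bridge_of_rooted_tree:
  assumes T: "tree_graph T" and e: "{x, y} \<in> uedges T"
    and root: "\<And>s t. {s, t} \<in> F \<Longrightarrow> {s, t} \<notin> uedges T \<Longrightarrow> s \<in> uverts T \<Longrightarrow> s = v"
  shows "(x, y) \<notin> (adjacency (F - {{x, y}}))\<^sup>*"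
proof
  define \<pi> where "\<pi> z = (if z \<in> uverts T then z else v)" for z
  have verts: "s \<in> uverts T" "t \<in> uverts T" if "{s, t} \<in> uedges T" for s t
    using T that by (auto simp: tree_graph_def simple_graph_def)
  have hop: "(\<pi> s, \<pi> t) \<in> (adjacency (uedges T - {{x, y}}))\<^sup>*"
    if "(s, t) \<in> adjacency (F - {{x, y}})" for s t
  proof (cases "{s, t} \<in> uedges T")
    case True
    then have "(\<pi> s, \<pi> t) \<in> adjacency (uedges T - {{x, y}})"
      using that verts by (simp add: \<pi>_def adjacency_def)
    then show ?thesis by blast
  next
    case False
    have "{s, t} \<in> F" "{t, s} \<in> F" using that by (auto simp: adjacency_def insert_commute)
    then have "\<pi> s = v" "\<pi> t = v"
      using False root[of s t] root[of t s] by (auto simp: \<pi>_def insert_commute)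
    then show ?thesis by simp
  qed
  have walk: "(\<pi> x, \<pi> z) \<in> (adjacency (uedges T - {{x, y}}))\<^sup>*"
    if "(x, z) \<in> (adjacency (F - {{x, y}}))\<^sup>*" for z
    using that
  proof (induction rule: rtrancl_induct)
    case (step s t)
    show ?case by (rule rtrancl_trans[OF step.IH hop[OF step.hyps(2)]])
  qed simp
  assume "(x, y) \<in> (adjacency (F - {{x, y}}))\<^sup>*"
  from walk[OF this] show False using tree_edge_bridge[OF T e] verts[OF e] by (simp add: \<pi>_def)
qed

lemma cycle_edges_verts: "e \<in> cycle_edges c \<Longrightarrow> e \<subseteq> set c"
  unfolding cycle_edges_def by (cases "c = []") (auto simp: mod_less_divisor)

text \<open>Put a trivial second tree at a cycle neighbour of the root.\<close>

lemma C5_with_one_tree_imp_two: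
  assumes "C5_with_one_tree G"
  shows "C5_with_two_adjacent_trees G"
proof -
  obtain D T v where D: "cycle_graph 5 D" and T: "tree_rooted_on D T v" and G: "G = graph_union D T"
    using assms unfolding C5_with_one_tree_def by blast
  obtain c where c: "distinct c" "length c = 5" "D = (set c, cycle_edges c)"
    using D unfolding cycle_graph_def by blast
  have "v \<in> set c" using T c(3) by (auto simp: tree_rooted_on_def)
  then obtain i where i: "i < 5" "v = c ! i" using c(2) by (auto simp: in_set_conv_nth)
  define w where "w = c ! (Suc i mod 5)"
  have vw: "{v, w} \<in> uedges D" using i c by (auto simp: w_def cycle_edges_def)
  have "i \<noteq> Suc i mod 5" using i(1) by (cases "i = 4") auto
  then have neq: "v \<noteq> w" using i c(1,2) by (simp add: w_def nth_eq_iff_index_eq)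
  have w: "w \<in> uverts D" using c(2) by (simp add: w_def c(3))
  have "tree_graph ({w}, {})"
    unfolding tree_graph_def
  proof (intro conjI)
    show "connected_graph ({w}, {})"
      unfolding connected_graph_joined by (auto intro!: exI[of _ 0] simp: joined_0)
    show "\<not> (\<exists>k. graph_has_cycle ({w}, {}) k)"
    proof
      assume "\<exists>k. graph_has_cycle ({w}, {}) k"
      then obtain k and D' :: "'a ugraph" where D': "cycle_graph k D'" "uedges D' \<subseteq> {}"
        unfolding graph_has_cycle_def snd_conv by blast
      \<comment> \<open>Any function, here a constant one, yields an edge of the cycle.\<close>
      show False using cycle_graph_max[OF D'(1), of "\<lambda>_. 0"] D'(2) by auto
    qed
  qed (simp add: simple_graph_def)
  then have "tree_rooted_on D ({w}, {}) w" using w by (simp add: tree_rooted_on_def)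
  moreover have "uverts T \<inter> uverts ({w}, {}) = {}"
    using T neq w by (auto simp: tree_rooted_on_def)
  moreover have "G = graph_union D (graph_union T ({w}, {}))"
    using w by (auto simp: G graph_union_def)
  ultimately show ?thesis
    unfolding C5_with_two_adjacent_trees_def using D T vw by blast
qed

context triangle_free_graph
begin

text \<open>The retraction sends each tree to its root and fixes the remaining vertices.\<close>

lemma pentagon_with_trees_of_two_adjacent_trees:
  assumes "C5_with_two_adjacent_trees G"
  shows "\<exists>a b c p q r. pentagon_with_trees G a b c p q r"
proof -
  obtain D T1 T2 v1 v2 where D: "cycle_graph 5 D" and v12: "{v1, v2} \<in> uedges D"
    and T1: "tree_rooted_on D T1 v1" and T2: "tree_rooted_on D T2 v2"
    and disj: "uverts T1 \<inter> uverts T2 = {}"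
    and G: "G = graph_union D (graph_union T1 T2)"
    using assms unfolding C5_with_two_adjacent_trees_def by blast
  obtain l where l: "distinct l" "length l = 5" "D = (set l, cycle_edges l)"
    using D unfolding cycle_graph_def by blast
  obtain a b c p q where abcpq: "l = [a, b, c, p, q]"
    using l(2) by (auto simp: numeral_eq_Suc length_Suc_conv)
  have E: "E = uedges D \<union> uedges T1 \<union> uedges T2" and V: "V = uverts D \<union> uverts T1 \<union> uverts T2"
    by (auto simp: G graph_union_def)
  have "pentagon a b c p q"
    using l(1) unfolding pentagon_def E l(3) abcpq by (simp add: cycle_edges_5)
  then interpret pentagon_graph G a b c p q by unfold_locales
  have CD: "C = uverts D" by (simp add: C_def l(3) abcpq)
  have tree1: "tree_graph T1" and tree2: "tree_graph T2"
    and root1: "\<And>x. x \<in> C \<Longrightarrow> x \<in> uverts T1 \<Longrightarrow> x = v1"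
    and root2: "\<And>x. x \<in> C \<Longrightarrow> x \<in> uverts T2 \<Longrightarrow> x = v2"
    and vC: "v1 \<in> C" "v2 \<in> C"
    using T1 T2 unfolding tree_rooted_on_def CD by blast+
  have inD: "x \<in> C \<and> y \<in> C" if "{x, y} \<in> uedges D" for x y
    using cycle_edges_verts[of "{x, y}" l] that by (simp add: l(3) CD)
  have inT1: "x \<in> uverts T1 \<and> y \<in> uverts T1" if "{x, y} \<in> uedges T1" for x y
    using tree1 that by (auto simp: tree_graph_def simple_graph_def)
  have inT2: "x \<in> uverts T2 \<and> y \<in> uverts T2" if "{x, y} \<in> uedges T2" for x y
    using tree2 that by (auto simp: tree_graph_def simple_graph_def)
  have bridge: "(x, y) \<notin> (adjacency (E - {{x, y}}))\<^sup>*"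
    if xy: "{x, y} \<in> uedges T1 \<union> uedges T2" for x y
    using xy
  proof
    assume T: "{x, y} \<in> uedges T1"
    show ?thesis
      by (rule bridge_of_rooted_tree[OF tree1 T, of _ v1]) (use inD inT2 root1 disj in \<open>unfold E, blast\<close>)
  next
    assume T: "{x, y} \<in> uedges T2"
    show ?thesis
      by (rule bridge_of_rooted_tree[OF tree2 T, of _ v2]) (use inD inT1 root2 disj in \<open>unfold E, blast\<close>)
  qed
  define r where "r x = (if x \<in> uverts T1 then v1 else if x \<in> uverts T2 then v2 else x)" for x
  have r_id: "r x = x" if "x \<in> C" for x
    using root1 root2 that by (auto simp: r_def)
  have "pentagon_with_trees G a b c p q r"
  proof unfold_locales
    show "r x \<in> C" if "x \<in> V" for x
      using that vC by (auto simp: r_def V CD)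
    show "r x = x" if "x \<in> C" for x by (rule r_id[OF that])
    show "r x = r y \<or> x \<in> C \<and> y \<in> C" if "{x, y} \<in> E" for x y
      using that inD inT1[of x y] inT2[of x y] disj unfolding E r_def by auto
    show "(x, y) \<notin> (adjacency (E - {{x, y}}))\<^sup>*" if "{x, y} \<in> E" "r x = r y" for x y
    proof (rule bridge)
      \<comment> \<open>Since \<open>r\<close> is the identity on \<open>C\<close>, a cycle edge
        with equal roots would be a loop.\<close>
      have "{x, y} \<notin> uedges D" using inD[of x y] r_id that edgeD(3)[OF that(1)] by metis
      then show "{x, y} \<in> uedges T1 \<union> uedges T2" using that(1) unfolding E by blast
    qed
    show "d (r x) (r y) \<noteq> 2" if "x \<in> V - C" "y \<in> V - C" for x y
    proof -
      have "r x \<in> {v1, v2}" "r y \<in> {v1, v2}" using that by (auto simp: r_def V CD)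
      moreover have "d v1 v2 = 1" "d v2 v1 = 1"
        using v12 d_edge[of v1 v2] d_commute[of v1 v2] unfolding E by auto
      ultimately show ?thesis using vC C_in_V by auto
    qed
  qed
  then show ?thesis by blast
qed

end

section \<open>Assembling the bound and the equality case\<close>

theorem theorem1p5:
  fixes G :: "'a ugraph" and n :: nat
  assumes "simple_graph G"
    and "connected_graph G"
    and "\<not> bipartite_graph G"
    and "n = card (uverts G)"
    and "n \<ge> 5"
    and "girth G \<ge> 5"
  shows "int (szeged_index G) - int (wiener_index G) \<ge> 2 * int n - 5 \<and>
    (int (szeged_index G) - int (wiener_index G) = 2 * int n - 5 \<longleftrightarrow>
       C5_with_one_tree G \<or> C5_with_two_adjacent_trees G)"
  proof -
  interpret connected_simple_graph G by unfold_locales (fact assms)+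
  let ?X = "\<Sum>x\<in>V. \<Sum>y\<in>V. excess x y"
  interpret triangle_free_graph G
  proof unfold_locales
    fix x y z assume e: "{x, y} \<in> E" "{y, z} \<in> E"
    \<comment> \<open>A triangle would bound the girth by 3.\<close>
    show "{x, z} \<notin> E"
    proof
      assume xz: "{x, z} \<in> E"
      note V = edgeD[OF e(1)] edgeD[OF e(2)] edgeD[OF xz]
      have "{..<3::nat} = {0, 1, 2}" by auto
      moreover have "cycle_edges [x, y, z] = (\<lambda>i. {[x, y, z] ! i, [x, y, z] ! (Suc i mod 3)}) ` {..<3}"
        unfolding cycle_edges_def by auto
      ultimately have "cycle_edges [x, y, z] = {{x, y}, {y, z}, {x, z}}"
        by (simp add: insert_commute)
      moreover have "cycle_graph 3 (set [x, y, z], cycle_edges [x, y, z])"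
        unfolding cycle_graph_def using V by (intro conjI exI[of _ "[x, y, z]"]) auto
      ultimately have "graph_has_cycle G 3"
        unfolding graph_has_cycle_def using e xz V
        by (intro exI[of _ "(set [x, y, z], cycle_edges [x, y, z])"]) simp
      then have "girth G \<le> enat 3" unfolding girth_def by (intro Inf_lower) blast
      with assms(6) have "(5::enat) \<le> enat 3" by (rule order_trans)
      then show False by (simp add: numeral_eq_enat)
    qed
  qed
  have lower: "4 * card V \<le> ?X + 10"
    and equality: "?X + 10 = 4 * card V \<Longrightarrow> C5_with_two_adjacent_trees G"
  proof -
    show "4 * card V \<le> ?X + 10"
    proof (cases "\<exists>a b c p q. pentagon a b c p q")
      case True
      then obtain a b c p q where "pentagon a b c p q" by blast
      then interpret pentagon_graph G a b c p q by unfold_locales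
      show ?thesis by (rule excess_sum_ge)
    next
      case False
      then show ?thesis using excess_sum_no_pentagon[OF assms(3)] by (simp add: trans_le_add1)
    qed
    assume eq: "?X + 10 = 4 * card V"
    \<comment> \<open>Without a five-cycle the sum is at least \<open>4 * card V\<close>, which
      excludes equality.\<close>
    then obtain a b c p q where "pentagon a b c p q"
      using excess_sum_no_pentagon[OF assms(3)] by fastforce
    then interpret tight_pentagon_graph G a b c p q by unfold_locales (use eq in auto)
    show "C5_with_two_adjacent_trees G" by (rule two_adjacent_trees)
  qed
  have upper: "?X + 10 \<le> 4 * card V" if trees: "C5_with_two_adjacent_trees G"
  proof -
    obtain a b c p q r where "pentagon_with_trees G a b c p q r"
      using pentagon_with_trees_of_two_adjacent_trees[OF trees] by blast
    then interpret pentagon_with_trees G a b c p q r .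
    show ?thesis by (rule excess_sum_le)
  qed
  have shape: "C5_with_one_tree G \<or> C5_with_two_adjacent_trees G \<longleftrightarrow> C5_with_two_adjacent_trees G"
    using C5_with_one_tree_imp_two by blast
  have "C5_with_two_adjacent_trees G \<longleftrightarrow> ?X + 10 = 4 * card V"
    using equality upper lower by (auto intro: le_antisym)
  \<comment> \<open>The sum \<open>?X\<close> is twice the difference of the indices, and
    \<open>4 * n - 10\<close> is twice \<open>2 * n - 5\<close>.\<close>
  then show ?thesis
    using szeged_minus_wiener lower unfolding shape assms(4) by linarith
qed

end
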